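(* For every $\epsilon>0$ there exists a natural number $N=N(\epsilon)$ such that for every graph $G$ on $n>N$ vertices, $f(G)\ge n/2-\epsilon n$. Consequently, $$n/2-o(n)\le f(n)\le n/2-\Omega(\log\log n).$$
   Context: All graphs are finite and simple. For a graph $G$, $f(G)$ denotes the largest integer $k$ such that there exist two vertex-disjoint sets $A,B\subseteq V(G)$ with $|A|=|B|=k$ such that the induced subgraphs $G[A]$ and $G[B]$ have the same number of edges. For a natural number $n$, $f(n)$ denotes the minimum of $f(G)$ over all graphs $G$ on $n$ vertices. The asymptotic notation refers to $n\to\infty$. *)

theory Defs
  imports Complex_Main "HOL-Library.Landau_Symbols"
begin

type_synonym 'a graph = "'a set \<times> 'a set set"

abbreviation verts :: "'a graph \<Rightarrow> 'a set" where "verts G \<equiv> fst G"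

abbreviation edges :: "'a graph \<Rightarrow> 'a set set" where "edges G \<equiv> snd G"

definition simple_graph :: "'a graph \<Rightarrow> bool" where
  "simple_graph G \<longleftrightarrow> finite (verts G) \<and> (\<forall>e\<in>edges G. e \<subseteq> verts G \<and> card e = 2)"

definition induced_subgraph :: "'a graph \<Rightarrow> 'a set \<Rightarrow> 'a graph" where
  "induced_subgraph G A = (A, {e \<in> edges G. e \<subseteq> A})"

(* For a simple graph the set contains 0 and is bounded by card (verts G), so the
   maximum exists. *)
definition max_equal_pair :: "'a graph \<Rightarrow> nat" where
  "max_equal_pair G = Max {k. \<exists>A B. A \<subseteq> verts G \<and> B \<subseteq> verts G \<and> A \<inter> B = {} \<and>
     card A = k \<and> card B = k \<and>
     card (edges (induced_subgraph G A)) = card (edges (induced_subgraph G B))}"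

(* Every graph on n vertices is isomorphic to one whose vertices are natural numbers, so
   this is the minimum over all graphs on n vertices. There are infinitely many graphs
   here, but the set of values is nonempty and bounded by n, so the minimum exists. *)
definition min_max_equal_pair :: "nat \<Rightarrow> nat" where
  "min_max_equal_pair n =
     Min {max_equal_pair G | G :: nat graph. simple_graph G \<and> card (verts G) = n}"

end

theory Submission
  imports Defs "HOL-Library.Discrete_Functions" "HOL-Real_Asymp.Real_Asymp"
begin

text \<open>
  Lower bound. If $W = A \cup B$ with $A$ and $B$ disjoint, then $2(e(A) - e(B))$ is the
  difference of the sums over $A$ and over $B$ of the degrees in $G[W]$. So we look for a large
  set $T$ of disjoint pairs of vertices for which some signed sum of the degree gaps within
  the pairs vanishes, degrees being counted in the graph induced by $T$. Such signs exist as soon as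
  no gap exceeds $\Gamma$, at least $3\Gamma$ gaps have the same value 1 or 2, and the sum of all gaps
  is divisible by 4. The last condition can be arranged by two pairs that interact (the switch): for one
  of the four ways of deleting some of them it holds. To start, put vertices into about $n^{1/5}$
  classes by degree, refined by the adjacency to the four vertices of the switch, and pair them within
  the classes; then all gaps are $O(n^{4/5})$ and no other pair notices whether the switch is deleted.
  If almost every gap depends on few pairs only, gaps of 1 or 2 are obtained one by one, by deleting all
  but one of the pairs on which a gap depends. Otherwise many small gaps depend
  on about $s$ pairs each for a common large $s$, and deleting every pair with probability of order
  $1/s$ turns a constant proportion of them into 1 or 2.

  Upper bound. Take disjoint cliques of odd orders that grow doubly exponentially. Working downwards from the
  largest one, each clique must be split evenly and therefore misses a vertex.
\<close>

section \<open>Signed pairings\<close>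

text \<open>The obstacle is arithmetic. Changing signs keeps a signed sum in its class modulo 2, and
  modulo 4 if all gaps are even, so a sum stuck at 2 modulo 4 cannot be repaired by signs alone; the
  set of pairs must change, and the switch does that. Gaps of 1 and 2 serve as fine weights because
  one pair contributes at most 2 to the gap of another: a single nonzero entry is such a gap, and
  lowering a large gap in steps of at most 2 cannot jump over both values. Let d be about n^(1/5).
  Rows with at most d nonzero entries have gaps at most 2d and need O(d) fine weights, which cost
  O(d^4) pairs; d^5 <= n turns this into O(n/d). For longer rows, pairing neighbours in the order of
  degree within each of the O(d) classes bounds the sum of all gaps by O(n), so all but a small
  share of them are at most a constant K. Then a random deletion produces a fine weight with
  probability depending on K only, and the one further loss is a logarithm, from grouping rows by
  the order of magnitude of their supports.\<close>

definition adj :: "'a graph \<Rightarrow> 'a \<Rightarrow> 'a \<Rightarrow> int" where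
  "adj G u v = of_bool ({u, v} \<in> edges G)"

text \<open>The contribution of the pair \<open>q\<close> to the degree gap of the pair
  \<open>p\<close>: row sums over a pairing are the gaps (\<open>sum_skew\<close>). The matrix is in
  general neither symmetric nor antisymmetric.\<close>

definition skew :: "'a graph \<Rightarrow> 'a \<times> 'a \<Rightarrow> 'a \<times> 'a \<Rightarrow> int" where
  "skew G p q = adj G (fst p) (fst q) + adj G (fst p) (snd q)
     - adj G (snd p) (fst q) - adj G (snd p) (snd q)"

definition pts :: "('a \<times> 'a) set \<Rightarrow> 'a set" where
  "pts P = fst ` P \<union> snd ` P"

definition pairing :: "('a \<times> 'a) set \<Rightarrow> bool" where
  "pairing P \<longleftrightarrow> finite P \<and> (\<forall>p\<in>P. fst p \<noteq> snd p) \<and>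
     (\<forall>p\<in>P. \<forall>q\<in>P. p \<noteq> q \<longrightarrow> {fst p, snd p} \<inter> {fst q, snd q} = {})"

definition is_sign :: "'p set \<Rightarrow> ('p \<Rightarrow> int) \<Rightarrow> bool" where
  "is_sign T \<sigma> \<longleftrightarrow> (\<forall>p\<in>T. \<sigma> p = 1 \<or> \<sigma> p = -1)"

text \<open>Stated for an arbitrary matrix, whose row sums over \<open>T\<close> play the role of
  gaps. Both sums run over \<open>T\<close>, so deleting a pair also changes the gaps that
  remain.\<close>

definition balanced :: "('p \<Rightarrow> 'p \<Rightarrow> int) \<Rightarrow> 'p set \<Rightarrow> bool" where
  "balanced c T \<longleftrightarrow> (\<exists>\<sigma>. is_sign T \<sigma> \<and> (\<Sum>p\<in>T. \<sigma> p * (\<Sum>q\<in>T. c p q)) = 0)"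

lemma adj_commute: "adj G u v = adj G v u"
  by (simp add: adj_def insert_commute)

lemma adj_self: "simple_graph G \<Longrightarrow> adj G u u = 0"
  by (auto simp: adj_def simple_graph_def)

lemma adj_cases: "adj G u v = 0 \<or> adj G u v = 1"
  by (simp add: adj_def)

lemma finite_induced_edges: "finite A \<Longrightarrow> finite (edges (induced_subgraph G A))"
  by (rule finite_subset[of _ "Pow A"]) (auto simp: induced_subgraph_def)

lemma twice_card_induced_edges:
  assumes "simple_graph G" "finite A"
  shows "2 * int (card (edges (induced_subgraph G A))) = (\<Sum>x\<in>A. \<Sum>y\<in>A. adj G x y)"
proof -
  let ?E = "edges (induced_subgraph G A)"
  let ?R = "{z \<in> A \<times> A. {fst z, snd z} \<in> edges G}"
  have fin: "finite ?E" using assms(2) by (rule finite_induced_edges)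
  have two: "card {z \<in> ?R. {fst z, snd z} = e} = 2" if "e \<in> ?E" for e
  proof -
    from that assms(1) have "card e = 2" and e: "e \<in> edges G" "e \<subseteq> A"
      by (auto simp: induced_subgraph_def simple_graph_def)
    then obtain x y where xy: "e = {x, y}" "x \<noteq> y" by (auto simp: card_2_iff)
    have "{z \<in> ?R. {fst z, snd z} = e} = {(x, y), (y, x)}"
      using xy e by (auto simp: doubleton_eq_iff insert_commute)
    with xy show ?thesis by simp
  qed
  have "(\<Sum>x\<in>A. \<Sum>y\<in>A. adj G x y) = (\<Sum>z\<in>A \<times> A. of_bool ({fst z, snd z} \<in> edges G))"
    by (simp add: sum.cartesian_product adj_def split_beta)
  also have "\<dots> = int (card ?R)"
    using assms(2) by (simp add: Int_def)
  also have "card ?R = (\<Sum>z\<in>?R. 1)" by simp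
  also have "(\<Sum>z\<in>?R. 1) = (\<Sum>e\<in>?E. \<Sum>z\<in>{z \<in> ?R. {fst z, snd z} = e}. 1)"
    by (rule sum.group[symmetric]) (use assms(2) fin in \<open>auto simp: induced_subgraph_def\<close>)
  also have "\<dots> = (\<Sum>e\<in>?E. card {z \<in> ?R. {fst z, snd z} = e})" by simp
  also have "\<dots> = (\<Sum>e\<in>?E. 2)" using two by (intro sum.cong) auto
  also have "\<dots> = 2 * card ?E" by simp
  finally show ?thesis by simp
qed

lemma max_equal_pair_set_finite:
  assumes "simple_graph G"
  shows "finite {k. \<exists>A B. A \<subseteq> verts G \<and> B \<subseteq> verts G \<and> A \<inter> B = {} \<and>
     card A = k \<and> card B = k \<and>
     card (edges (induced_subgraph G A)) = card (edges (induced_subgraph G B))}"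
  by (rule finite_subset[of _ "{..card (verts G)}"])
    (use assms in \<open>auto simp: simple_graph_def intro: card_mono\<close>)

lemma max_equal_pair_ge:
  assumes "simple_graph G" "A \<subseteq> verts G" "B \<subseteq> verts G" "A \<inter> B = {}" "card A = k" "card B = k"
    "card (edges (induced_subgraph G A)) = card (edges (induced_subgraph G B))"
  shows "max_equal_pair G \<ge> k"
  unfolding max_equal_pair_def
  by (rule Max_ge[OF max_equal_pair_set_finite[OF assms(1)]]) (use assms in blast)

lemma max_equal_pair_witness:
  assumes "simple_graph G"
  obtains A B where "A \<subseteq> verts G" "B \<subseteq> verts G" "A \<inter> B = {}"
    "card A = max_equal_pair G" "card B = max_equal_pair G"
    "card (edges (induced_subgraph G A)) = card (edges (induced_subgraph G B))"
proof -
  let ?S = "{k. \<exists>A B. A \<subseteq> verts G \<and> B \<subseteq> verts G \<and> A \<inter> B = {} \<and>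
     card A = k \<and> card B = k \<and>
     card (edges (induced_subgraph G A)) = card (edges (induced_subgraph G B))}"
  have "0 \<in> ?S" by (auto intro!: exI[of _ "{}"])
  then have "Max ?S \<in> ?S" using max_equal_pair_set_finite[OF assms] by (intro Max_in) auto
  then show ?thesis using that unfolding max_equal_pair_def by blast
qed

lemma pairing_selection:
  assumes "pairing T" "\<And>p. p \<in> T \<Longrightarrow> s p \<in> {fst p, snd p}" "\<And>p. p \<in> T \<Longrightarrow> t p \<in> {fst p, snd p}"
    "p \<in> T" "q \<in> T" "s p = t q"
  shows "p = q"
  using assms unfolding pairing_def by (metis disjoint_iff)

lemma balanced_imp_max_equal_pair_ge:
  assumes G: "simple_graph G" and T: "pairing T" and V: "pts T \<subseteq> verts G"
    and bal: "balanced (skew G) T"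
  shows "card T \<le> max_equal_pair G"
proof -
  obtain \<sigma> where \<sigma>: "is_sign T \<sigma>" "(\<Sum>p\<in>T. \<sigma> p * (\<Sum>q\<in>T. skew G p q)) = 0"
    using bal by (auto simp: balanced_def)
  define hi where "hi p = (if \<sigma> p = 1 then fst p else snd p)" for p
  define lo where "lo p = (if \<sigma> p = 1 then snd p else fst p)" for p
  have fT: "finite T" using T by (simp add: pairing_def)
  have sel: "hi p \<in> {fst p, snd p}" "lo p \<in> {fst p, snd p}" for p
    by (auto simp: hi_def lo_def)
  have injh: "inj_on hi T" by (intro inj_onI pairing_selection[OF T, of hi hi]) (use sel in auto)
  have injl: "inj_on lo T" by (intro inj_onI pairing_selection[OF T, of lo lo]) (use sel in auto)
  have ne: "hi p \<noteq> lo q" if "p \<in> T" "q \<in> T" for p q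
  proof
    assume e: "hi p = lo q"
    then have "p = q" using pairing_selection[OF T, of hi lo p q] sel that by auto
    with e that T show False by (auto simp: hi_def lo_def pairing_def split: if_splits)
  qed
  have eh: "2 * int (card (edges (induced_subgraph G (hi ` T)))) = (\<Sum>p\<in>T. \<Sum>q\<in>T. adj G (hi p) (hi q))"
    using twice_card_induced_edges[OF G, of "hi ` T"] fT injh by (simp add: sum.reindex)
  have el: "2 * int (card (edges (induced_subgraph G (lo ` T)))) = (\<Sum>p\<in>T. \<Sum>q\<in>T. adj G (lo p) (lo q))"
    using twice_card_induced_edges[OF G, of "lo ` T"] fT injl by (simp add: sum.reindex)
  \<comment> \<open>Edges between the two sides are counted once from each side, so they cancel and
    only edges inside the sides remain.\<close>
  have cross: "(\<Sum>p\<in>T. \<Sum>q\<in>T. adj G (hi p) (lo q)) = (\<Sum>p\<in>T. \<Sum>q\<in>T. adj G (lo p) (hi q))"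
    by (subst sum.swap) (simp add: adj_commute)
  have "\<sigma> p * skew G p q = adj G (hi p) (hi q) + adj G (hi p) (lo q)
      - adj G (lo p) (hi q) - adj G (lo p) (lo q)" if "p \<in> T" "q \<in> T" for p q
    using \<sigma>(1) that by (auto simp: is_sign_def hi_def lo_def skew_def)
  then have "0 = (\<Sum>p\<in>T. \<Sum>q\<in>T. adj G (hi p) (hi q) + adj G (hi p) (lo q)
      - adj G (lo p) (hi q) - adj G (lo p) (lo q))"
    using \<sigma>(2) by (simp add: sum_distrib_left)
  also have "\<dots> = (\<Sum>p\<in>T. \<Sum>q\<in>T. adj G (hi p) (hi q)) - (\<Sum>p\<in>T. \<Sum>q\<in>T. adj G (lo p) (lo q))"
    using cross by (simp add: sum.distrib sum_subtractf)
  finally have "card (edges (induced_subgraph G (hi ` T))) = card (edges (induced_subgraph G (lo ` T)))"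
    using eh el by simp
  moreover have "hi ` T \<subseteq> verts G" "lo ` T \<subseteq> verts G"
    using V by (auto simp: pts_def hi_def lo_def)
  moreover have "hi ` T \<inter> lo ` T = {}" using ne by blast
  ultimately show ?thesis
    using max_equal_pair_ge[OF G, of "hi ` T" "lo ` T" "card T"] card_image[OF injh] card_image[OF injl]
    by blast
qed

lemma skew_self: "simple_graph G \<Longrightarrow> skew G p p = 0"
  by (simp add: skew_def adj_self adj_commute)

lemma abs_skew_le: "\<bar>skew G p q\<bar> \<le> 2"
  using adj_cases[of G "fst p" "fst q"] adj_cases[of G "fst p" "snd q"]
    adj_cases[of G "snd p" "fst q"] adj_cases[of G "snd p" "snd q"]
  unfolding skew_def by linarith

lemma even_skew_add: "even (skew G p q + skew G q p)"
  by (simp add: skew_def adj_commute[of G "fst q"] adj_commute[of G "snd q"])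

text \<open>Let a, b, c, d be the adjacencies in the order in which \<open>skew G p q\<close> lists
  them. It equals (a - d) + (b - c), while the two combinations in the conclusion are 2(a - d) and
  2(c - b). If it is nonzero, one of a - d and b - c is 1 or -1.\<close>

lemma skew_mod_4:
  assumes "skew G p q \<noteq> 0"
  shows "(skew G p q + skew G q p) mod 4 = 2 \<or> (- skew G p q + skew G q p) mod 4 = 2"
proof -
  have *: "skew G q p = adj G (fst p) (fst q) + adj G (snd p) (fst q)
      - adj G (fst p) (snd q) - adj G (snd p) (snd q)"
    by (simp add: skew_def adj_commute[of G "fst q"] adj_commute[of G "snd q"])
  show ?thesis
    using adj_cases[of G "fst p" "fst q"] adj_cases[of G "fst p" "snd q"]
      adj_cases[of G "snd p" "fst q"] adj_cases[of G "snd p" "snd q"] assms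
    unfolding * unfolding skew_def by (elim disjE) simp_all
qed

section \<open>Choosing signs\<close>

text \<open>What the sign arguments retain of a graph. The parity condition makes every signed total
  even; the last condition lets a nonzero entry shift a total by 2 modulo 4, through the relative
  sign of its two indices.\<close>

definition cross_matrix :: "('p \<Rightarrow> 'p \<Rightarrow> int) \<Rightarrow> bool" where
  "cross_matrix c \<longleftrightarrow> (\<forall>p. c p p = 0) \<and> (\<forall>p q. \<bar>c p q\<bar> \<le> 2) \<and> (\<forall>p q. even (c p q + c q p)) \<and>
     (\<forall>p q. c p q \<noteq> 0 \<longrightarrow> (c p q + c q p) mod 4 = 2 \<or> (- c p q + c q p) mod 4 = 2)"

lemma cross_matrix_skew: "simple_graph G \<Longrightarrow> cross_matrix (skew G)"
  unfolding cross_matrix_def using skew_self abs_skew_le even_skew_add skew_mod_4 by blast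

text \<open>Giving each new term the sign opposite to the running total keeps that total within the
  bound on single terms.\<close>

lemma greedy_signs:
  fixes g :: "'p \<Rightarrow> int"
  assumes "finite S" "\<And>p. p \<in> S \<Longrightarrow> \<bar>g p\<bar> \<le> \<Gamma>" "\<Gamma> \<ge> 0"
  shows "\<exists>\<sigma>. is_sign S \<sigma> \<and> \<bar>\<Sum>p\<in>S. \<sigma> p * g p\<bar> \<le> \<Gamma>"
  using assms(1,2)
proof (induction S rule: finite_induct)
  case empty
  then show ?case using assms(3) by (auto simp: is_sign_def)
next
  case (insert x S)
  then obtain \<sigma> where \<sigma>: "is_sign S \<sigma>" "\<bar>\<Sum>p\<in>S. \<sigma> p * g p\<bar> \<le> \<Gamma>" by auto
  let ?t = "\<Sum>p\<in>S. \<sigma> p * g p"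
  define e :: int where "e = (if ?t * g x \<ge> 0 then -1 else 1)"
  have "is_sign (insert x S) (\<sigma>(x := e))"
    using \<sigma>(1) insert.hyps by (auto simp: is_sign_def e_def)
  moreover have "(\<Sum>p\<in>insert x S. (\<sigma>(x := e)) p * g p) = e * g x + ?t"
    using insert.hyps by (simp add: sum.insert) (intro sum.cong, auto)
  moreover have "\<bar>e * g x + ?t\<bar> \<le> \<Gamma>"
    using \<sigma>(2) insert.prems[of x] zero_le_mult_iff[of ?t "g x"]
    by (auto simp: e_def)
  ultimately show ?case by (intro exI[of _ "\<sigma>(x := e)"]) (simp only: simp_thms)
qed

text \<open>Signed sums of terms of absolute value \<open>v\<close> run through an interval in steps
  of 2v; the target \<open>t\<close> determines the number \<open>j\<close> of terms that are to
  count as \<open>v\<close>.\<close>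

lemma constant_abs_signs:
  fixes g :: "'p \<Rightarrow> int"
  assumes "finite S" "\<And>p. p \<in> S \<Longrightarrow> \<bar>g p\<bar> = v" "v > 0"
    and t: "\<bar>t\<bar> \<le> v * int (card S)" "2 * v dvd t + v * int (card S)"
  shows "\<exists>\<sigma>. is_sign S \<sigma> \<and> (\<Sum>p\<in>S. \<sigma> p * g p) = t"
proof -
  obtain j where j: "t + v * int (card S) = 2 * v * j" using t(2) by blast
  have "0 \<le> 2 * v * j" using j t(1) by linarith
  then have j0: "0 \<le> j" using \<open>v > 0\<close> by (simp add: zero_le_mult_iff)
  have "2 * v * j \<le> 2 * v * int (card S)" using j t(1) by linarith
  then have "j \<le> int (card S)" using \<open>v > 0\<close> by simp
  then obtain Y where Y: "Y \<subseteq> S" "card Y = nat j"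
    by (metis nat_le_iff obtain_subset_with_card_n)
  define \<sigma> where "\<sigma> p = (if p \<in> Y then sgn (g p) else - sgn (g p))" for p
  have *: "\<sigma> p * g p = (if p \<in> Y then v else - v)" if "p \<in> S" for p
    using assms(2)[OF that] assms(3) by (auto simp: \<sigma>_def sgn_if)
  have sg: "is_sign S \<sigma>"
    using assms(2,3) by (fastforce simp: is_sign_def \<sigma>_def sgn_if)
  have "(\<Sum>p\<in>S. \<sigma> p * g p) = (\<Sum>p\<in>S. if p \<in> Y then v else - v)"
    using * by (intro sum.cong) auto
  also have "\<dots> = v * card Y - v * card (S - Y)"
    using assms(1) Y(1) by (simp add: sum.If_cases Int_absorb1 Diff_eq[symmetric] Int_commute)
  also have "\<dots> = t"
    using assms(1) Y j j0 card_mono[OF assms(1) Y(1)]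
    by (simp add: card_Diff_subset finite_subset of_nat_diff algebra_simps)
  finally show ?thesis using sg by blast
qed

lemma even_signed_sum:
  fixes g :: "'p \<Rightarrow> int"
  assumes "is_sign S \<sigma>" "is_sign S \<tau>"
  shows "even ((\<Sum>p\<in>S. \<sigma> p * g p) - (\<Sum>p\<in>S. \<tau> p * g p))"
  unfolding sum_subtractf[symmetric]
  by (rule dvd_sum) (use assms in \<open>auto simp: is_sign_def algebra_simps\<close>)

lemma four_dvd_signed_sum:
  fixes g :: "'p \<Rightarrow> int"
  assumes "is_sign S \<sigma>" "is_sign S \<tau>" "\<And>p. p \<in> S \<Longrightarrow> even (g p)"
  shows "4 dvd ((\<Sum>p\<in>S. \<sigma> p * g p) - (\<Sum>p\<in>S. \<tau> p * g p))"
  unfolding sum_subtractf[symmetric]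
proof (rule dvd_sum)
  fix p assume "p \<in> S"
  then obtain h where "g p = 2 * h" using assms(3) by blast
  then show "4 dvd \<sigma> p * g p - \<tau> p * g p"
    using assms(1,2)[unfolded is_sign_def, rule_format, OF \<open>p \<in> S\<close>]
    by (elim disjE) simp_all
qed

text \<open>The terms outside \<open>\<Omega>\<close> are summed greedily and those in
  \<open>\<Omega>\<close> cancel the remainder. With v = 1 only parity has to agree, and signs
  cannot change it. With v = 2 a remainder in the wrong class modulo 4 is moved by flipping one odd
  term outside \<open>\<Omega>\<close>; if there is none, all terms are even, the class modulo 4 is
  independent of the signs, and the hypothesis on \<open>\<tau>\<close> settles it. A flip adds at
  most 2\<Gamma> to a remainder of at most \<Gamma>, hence the factor 3.\<close>

lemma zero_signed_sum:
  fixes g :: "'p \<Rightarrow> int"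
  assumes fin: "finite T" and bound: "\<And>p. p \<in> T \<Longrightarrow> \<bar>g p\<bar> \<le> \<Gamma>" and "\<Gamma> \<ge> 0"
    and \<Omega>: "\<Omega> \<subseteq> T" "\<And>p. p \<in> \<Omega> \<Longrightarrow> \<bar>g p\<bar> = v" "v = 1 \<or> v = 2"
    and many: "3 * \<Gamma> \<le> int (card \<Omega>)"
    and \<tau>: "is_sign T \<tau>" "4 dvd (\<Sum>p\<in>T. \<tau> p * g p)"
  shows "\<exists>\<sigma>. is_sign T \<sigma> \<and> (\<Sum>p\<in>T. \<sigma> p * g p) = 0"
proof -
  define S where "S = T - \<Omega>"
  have fS: "finite S" "finite \<Omega>" using fin \<Omega>(1) by (auto simp: S_def finite_subset)
  have split: "(\<Sum>p\<in>T. f p * g p) = (\<Sum>p\<in>S. f p * g p) + (\<Sum>p\<in>\<Omega>. f p * g p)" for f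
    unfolding S_def by (rule sum.subset_diff[OF \<Omega>(1) fin])
  have \<tau>S: "is_sign S \<tau>" and \<tau>\<Omega>: "is_sign \<Omega> \<tau>"
    using \<tau>(1) \<Omega>(1) by (auto simp: S_def is_sign_def)
  have v0: "v > 0" using \<Omega>(3) by auto
  have join: ?thesis
    if \<sigma>: "is_sign S \<sigma>" and small: "\<bar>\<Sum>p\<in>S. \<sigma> p * g p\<bar> \<le> v * int (card \<Omega>)"
      and dv: "2 * v dvd - (\<Sum>p\<in>S. \<sigma> p * g p) + v * int (card \<Omega>)" for \<sigma>
  proof -
    obtain \<rho> where \<rho>: "is_sign \<Omega> \<rho>" "(\<Sum>p\<in>\<Omega>. \<rho> p * g p) = - (\<Sum>p\<in>S. \<sigma> p * g p)"
      using constant_abs_signs[OF fS(2) _ v0, where g = g and t = "- (\<Sum>p\<in>S. \<sigma> p * g p)"] \<Omega>(2) small dv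
      by auto
    let ?f = "\<lambda>p. if p \<in> \<Omega> then \<rho> p else \<sigma> p"
    have "(\<Sum>p\<in>S. ?f p * g p) = (\<Sum>p\<in>S. \<sigma> p * g p)"
      by (intro sum.cong) (auto simp: S_def)
    moreover have "(\<Sum>p\<in>\<Omega>. ?f p * g p) = (\<Sum>p\<in>\<Omega>. \<rho> p * g p)"
      by (intro sum.cong) auto
    ultimately have "(\<Sum>p\<in>T. ?f p * g p) = 0" using split[of ?f] \<rho>(2) by simp
    moreover have "is_sign T ?f" using \<sigma> \<rho>(1) by (auto simp: is_sign_def S_def)
    ultimately show ?thesis by (intro exI[of _ ?f]) simp
  qed
  obtain \<sigma> where \<sigma>: "is_sign S \<sigma>" "\<bar>\<Sum>p\<in>S. \<sigma> p * g p\<bar> \<le> \<Gamma>"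
    using greedy_signs[OF fS(1) _ \<open>\<Gamma> \<ge> 0\<close>, of g] bound S_def by blast
  let ?x = "\<Sum>p\<in>S. \<sigma> p * g p"
  have par: "even (?x + (\<Sum>p\<in>\<Omega>. \<tau> p * g p))"
    using even_signed_sum[OF \<sigma>(1) \<tau>S, of g] \<tau>(2) split[of \<tau>] by presburger
  obtain \<mu> where \<mu>: "is_sign \<Omega> \<mu>" "(\<Sum>p\<in>\<Omega>. \<mu> p * g p) = v * int (card \<Omega>)"
    using constant_abs_signs[OF fS(2) _ v0, where g = g and t = "v * int (card \<Omega>)"] \<Omega>(2,3)
    by (auto simp: abs_mult)
  show ?thesis
  proof (cases "v = 1")
    case True
    have "(\<Sum>p\<in>\<Omega>. \<mu> p * g p) = int (card \<Omega>)" using \<mu>(2) True by simp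
    then have "even (?x + int (card \<Omega>))"
      using even_signed_sum[OF \<mu>(1) \<tau>\<Omega>, of g] par by presburger
    then show ?thesis
      by (intro join[OF \<sigma>(1)]) (use \<sigma>(2) many \<open>\<Gamma> \<ge> 0\<close> True in \<open>simp_all\<close>)
  next
    case False
    then have v: "v = 2" using \<Omega>(3) by simp
    have ev\<Omega>: "even (g p)" if "p \<in> \<Omega>" for p
      using \<Omega>(2)[OF that] v by presburger
    have w: "4 dvd 2 * int (card \<Omega>) - (\<Sum>p\<in>\<Omega>. \<tau> p * g p)"
      using four_dvd_signed_sum[OF \<mu>(1) \<tau>\<Omega>, of g] ev\<Omega> \<mu>(2) v by simp
    show ?thesis
    proof (cases "4 dvd - ?x + 2 * int (card \<Omega>)")
      case True
      then show ?thesis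
        by (intro join[OF \<sigma>(1)]) (use \<sigma>(2) many \<open>\<Gamma> \<ge> 0\<close> v in \<open>simp_all\<close>)
    next
      case no: False
      have "\<exists>s\<in>S. odd (g s)"
      proof (rule ccontr)
        assume "\<not> ?thesis"
        then have ev: "even (g p)" if "p \<in> S" for p using that by blast
        then have "4 dvd ?x - (\<Sum>p\<in>S. \<tau> p * g p)"
          using four_dvd_signed_sum[OF \<sigma>(1) \<tau>S, of g] by blast
        moreover have "even ?x" using ev by (intro dvd_sum) auto
        ultimately show False using no w \<tau>(2) split[of \<tau>] by presburger
      qed
      then obtain s where s: "s \<in> S" "odd (g s)" by blast
      let ?\<sigma> = "\<sigma>(s := - \<sigma> s)"
      have "(\<Sum>p\<in>S. ?\<sigma> p * g p) = - \<sigma> s * g s + (\<Sum>p\<in>S - {s}. \<sigma> p * g p)"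
        using s(1) fS(1) by (subst sum.remove[of S s]) (auto intro!: sum.cong)
      also have "(\<Sum>p\<in>S - {s}. \<sigma> p * g p) = ?x - \<sigma> s * g s"
        using s(1) fS(1) by (simp add: sum_diff1)
      finally have fl: "(\<Sum>p\<in>S. ?\<sigma> p * g p) = ?x - 2 * (\<sigma> s * g s)" by simp
      have sg: "is_sign S ?\<sigma>" using \<sigma>(1) s(1) by (auto simp: is_sign_def)
      have ss: "\<bar>\<sigma> s * g s\<bar> \<le> \<Gamma>" "odd (\<sigma> s * g s)"
        using \<sigma>(1)[unfolded is_sign_def, rule_format, OF s(1)] s bound[of s]
        by (auto simp: S_def)
      have "even ?x" using par w by presburger
      moreover obtain y where y: "\<sigma> s * g s = y" by simp
      ultimately have "4 dvd - (?x - 2 * (\<sigma> s * g s)) + 2 * int (card \<Omega>)"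
        using no ss(2) unfolding y by presburger
      moreover have "\<bar>?x - 2 * (\<sigma> s * g s)\<bar> \<le> 2 * int (card \<Omega>)"
        using ss(1) \<sigma>(2) many \<open>\<Gamma> \<ge> 0\<close> by linarith
      ultimately show ?thesis
        by (intro join[OF sg]) (use v fl in \<open>simp_all\<close>)
    qed
  qed
qed

text \<open>The signs \<open>\<tau>\<close> stay fixed while \<open>T\<close> varies, so that the
  totals for the four outcomes of the switch can be compared.\<close>

definition weighted :: "('p \<Rightarrow> int) \<Rightarrow> ('p \<Rightarrow> 'p \<Rightarrow> int) \<Rightarrow> 'p set \<Rightarrow> int" where
  "weighted \<tau> c T = (\<Sum>p\<in>T. \<tau> p * (\<Sum>q\<in>T. c p q))"

lemma weighted_insert:
  assumes "finite T" "x \<notin> T" "c x x = 0"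
  shows "weighted \<tau> c (insert x T)
    = weighted \<tau> c T + (\<Sum>q\<in>T. \<tau> x * c x q + \<tau> q * c q x)"
  using assms by (simp add: weighted_def sum.distrib sum_distrib_left algebra_simps)

lemma even_weighted:
  assumes c: "cross_matrix c" and \<tau>: "\<And>p. \<tau> p = 1 \<or> \<tau> p = -1" and "finite T"
  shows "even (weighted \<tau> c T)"
  using \<open>finite T\<close>
proof (induction T rule: finite_induct)
  case empty
  then show ?case by (simp add: weighted_def)
next
  case (insert x T)
  have "even (\<tau> x * c x q + \<tau> q * c q x)" for q
  proof -
    have "even (c x q + c q x)" using c by (simp add: cross_matrix_def)
    then show ?thesis using \<tau>[of x] \<tau>[of q] by (elim disjE) simp_all
  qed
  then have "even (\<Sum>q\<in>T. \<tau> x * c x q + \<tau> q * c q x)" by (intro dvd_sum) blast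
  then show ?case
    using insert c by (simp add: weighted_insert cross_matrix_def)
qed


(* The alternating sum of the four candidate values is 2 modulo 4, while each of them is even,
   so they cannot all be 2 modulo 4. *)
lemma switch:
  assumes c: "cross_matrix c" and T: "finite T" "i \<notin> T" "j \<notin> T" and ij: "c i j \<noteq> 0"
  shows "\<exists>D \<tau>. D \<subseteq> {i, j} \<and> is_sign (T \<union> D) \<tau> \<and> 4 dvd weighted \<tau> c (T \<union> D)"
proof -
  have cc: "c p p = 0" for p using c by (simp add: cross_matrix_def)
  have "i \<noteq> j" using ij cc by auto
  have "(c i j + c j i) mod 4 = 2 \<or> (- c i j + c j i) mod 4 = 2"
    using c ij unfolding cross_matrix_def by blast
  \<comment> \<open>The sign of \<open>i\<close> relative to \<open>j\<close> is chosen so that the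
    contribution present only when both are kept is 2 modulo 4.\<close>
  then obtain e :: int where e: "e = 1 \<or> e = -1" "(e * c i j + c j i) mod 4 = 2"
    by (metis mult_1 mult_minus1)
  define \<tau> where "\<tau> p = (if p = i then e else 1)" for p
  have \<tau>: "\<tau> p = 1 \<or> \<tau> p = -1" for p using e(1) by (simp add: \<tau>_def)
  let ?w = "weighted \<tau> c"
  have 1: "?w (insert i T) = ?w T + (\<Sum>q\<in>T. \<tau> i * c i q + \<tau> q * c q i)"
    using T by (intro weighted_insert cc)
  have 2: "?w (insert j T) = ?w T + (\<Sum>q\<in>T. \<tau> j * c j q + \<tau> q * c q j)"
    using T by (intro weighted_insert cc)
  have "?w (insert j (insert i T))
      = ?w (insert i T) + (\<Sum>q\<in>insert i T. \<tau> j * c j q + \<tau> q * c q j)"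
    using T \<open>i \<noteq> j\<close> by (intro weighted_insert cc) auto
  also have "(\<Sum>q\<in>insert i T. \<tau> j * c j q + \<tau> q * c q j)
      = (e * c i j + c j i) + (\<Sum>q\<in>T. \<tau> j * c j q + \<tau> q * c q j)"
    using T \<open>i \<noteq> j\<close> by (simp add: \<tau>_def)
  finally have 3: "?w (insert j (insert i T)) = ?w (insert i T) + ?w (insert j T) - ?w T + (e * c i j + c j i)"
    using 2 by simp
  have ev: "even (?w T)" "even (?w (insert i T))" "even (?w (insert j T))"
    using T by (auto intro!: even_weighted[OF c \<tau>])
  have "4 dvd ?w T \<or> 4 dvd ?w (insert i T) \<or> 4 dvd ?w (insert j T) \<or> 4 dvd ?w (insert j (insert i T))"
    using 3 ev e(2) by presburger
  moreover have "is_sign S \<tau>" for S using \<tau> by (simp add: is_sign_def)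
  moreover have "T \<union> {} = T" "T \<union> {i} = insert i T" "T \<union> {j} = insert j T"
    "T \<union> {i, j} = insert j (insert i T)" by auto
  ultimately show ?thesis by (metis empty_subsetI insert_commute subset_insertI subset_refl insert_mono)
qed

text \<open>The fine weights must be fixed before the switch is decided. Since the rows in
  \<open>\<Omega>\<close> vanish at \<open>i\<close> and \<open>j\<close>, their gaps are the same
  for all choices of \<open>D\<close>. The factor 6 leaves \<open>3 * \<Gamma>\<close> equal gaps
  after a pigeonhole between the values 1 and 2.\<close>

lemma balanced_by_units:
  assumes c: "cross_matrix c" and T: "finite T" "i \<notin> T" "j \<notin> T" and ij: "c i j \<noteq> 0"
    and bound: "\<And>D p. D \<subseteq> {i, j} \<Longrightarrow> p \<in> T \<union> D \<Longrightarrow> \<bar>\<Sum>q\<in>T \<union> D. c p q\<bar> \<le> \<Gamma>" and "\<Gamma> \<ge> 0"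
    and \<Omega>: "\<Omega> \<subseteq> T" "\<And>p. p \<in> \<Omega> \<Longrightarrow> c p i = 0 \<and> c p j = 0"
      "\<And>p. p \<in> \<Omega> \<Longrightarrow> \<bar>\<Sum>q\<in>T. c p q\<bar> = 1 \<or> \<bar>\<Sum>q\<in>T. c p q\<bar> = 2"
    and many: "6 * \<Gamma> \<le> int (card \<Omega>)"
  shows "\<exists>D\<subseteq>{i, j}. balanced c (T \<union> D)"
proof -
  obtain D \<tau> where D: "D \<subseteq> {i, j}" "is_sign (T \<union> D) \<tau>" "4 dvd weighted \<tau> c (T \<union> D)"
    using switch[OF c T ij] by blast
  let ?g = "\<lambda>p. \<Sum>q\<in>T \<union> D. c p q"
  have fD: "finite D" "T \<inter> D = {}" using D(1) T finite_subset by auto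
  have g\<Omega>: "?g p = (\<Sum>q\<in>T. c p q)" if "p \<in> \<Omega>" for p
  proof -
    have "(\<Sum>q\<in>D. c p q) = 0" using D(1) \<Omega>(2)[OF that] by (intro sum.neutral) auto
    then show ?thesis using fD T(1) by (simp add: sum.union_disjoint)
  qed
  define \<Omega>' where "\<Omega>' v = {p \<in> \<Omega>. \<bar>?g p\<bar> = v}" for v
  have f\<Omega>: "finite \<Omega>" using \<Omega>(1) T(1) finite_subset by blast
  have "\<Omega> = \<Omega>' 1 \<union> \<Omega>' 2" using \<Omega>(3) g\<Omega> unfolding \<Omega>'_def by fastforce
  then have "card \<Omega> \<le> card (\<Omega>' 1) + card (\<Omega>' 2)" by (metis card_Un_le)
  then have "3 * \<Gamma> \<le> int (card (\<Omega>' 1)) \<or> 3 * \<Gamma> \<le> int (card (\<Omega>' 2))"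
    using many by linarith
  then obtain v where v: "v = 1 \<or> v = 2" "3 * \<Gamma> \<le> int (card (\<Omega>' v))" by blast
  have "\<exists>\<sigma>. is_sign (T \<union> D) \<sigma> \<and> (\<Sum>p\<in>T \<union> D. \<sigma> p * ?g p) = 0"
    by (rule zero_signed_sum[where \<Gamma> = \<Gamma> and v = v and \<Omega> = "\<Omega>' v" and \<tau> = \<tau>])
      (use T(1) fD bound[OF D(1)] \<open>\<Gamma> \<ge> 0\<close> \<Omega>(1) v D in \<open>auto simp: \<Omega>'_def weighted_def\<close>)
  then show ?thesis using D(1) by (auto simp: balanced_def)
qed

section \<open>Matrices with sparse rows\<close>

lemma balanced_if_zero: "(\<And>p q. p \<in> T \<Longrightarrow> q \<in> T \<Longrightarrow> c p q = 0) \<Longrightarrow> balanced c T"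
  by (auto simp: balanced_def is_sign_def intro!: exI[of _ "\<lambda>_. 1"])

text \<open>Double counting of the nonzero entries, by rows and by columns.\<close>

lemma card_heavy_columns_le:
  fixes c :: "'p \<Rightarrow> 'p \<Rightarrow> int"
  assumes "finite P" "\<And>p. p \<in> P \<Longrightarrow> card {q \<in> P. c p q \<noteq> 0} \<le> D"
  shows "C * card {q \<in> P. C < card {p \<in> P. c p q \<noteq> 0}} \<le> D * card P"
proof -
  let ?H = "{q \<in> P. C < card {p \<in> P. c p q \<noteq> 0}}"
  have "C * card ?H = (\<Sum>q\<in>?H. C)" by simp
  also have "\<dots> \<le> (\<Sum>q\<in>?H. card {p \<in> P. c p q \<noteq> 0})" by (intro sum_mono) auto
  also have "\<dots> \<le> (\<Sum>q\<in>P. card {p \<in> P. c p q \<noteq> 0})"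
    using assms(1) by (intro sum_mono2) auto
  also have "\<dots> = (\<Sum>q\<in>P. \<Sum>p\<in>P. of_bool (c p q \<noteq> 0))"
    using assms(1) by (simp add: Int_def)
  also have "\<dots> = (\<Sum>p\<in>P. \<Sum>q\<in>P. of_bool (c p q \<noteq> 0))" by (rule sum.swap)
  also have "\<dots> = (\<Sum>p\<in>P. card {q \<in> P. c p q \<noteq> 0})"
    using assms(1) by (simp add: Int_def)
  also have "\<dots> \<le> (\<Sum>p\<in>P. D)" using assms(2) by (intro sum_mono) auto
  finally show ?thesis by (simp add: mult.commute)
qed

lemma abs_row_sum_le:
  fixes c :: "'p \<Rightarrow> 'p \<Rightarrow> int"
  assumes "cross_matrix c" "finite T"
  shows "\<bar>\<Sum>q\<in>T. c p q\<bar> \<le> 2 * int (card {q \<in> T. c p q \<noteq> 0})"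
proof -
  have "(\<Sum>q\<in>T. c p q) = (\<Sum>q\<in>{q \<in> T. c p q \<noteq> 0}. c p q)"
    using assms(2) by (intro sum.mono_neutral_right) auto
  also have "\<bar>\<dots>\<bar> \<le> (\<Sum>q\<in>{q \<in> T. c p q \<noteq> 0}. \<bar>c p q\<bar>)" by (rule sum_abs)
  also have "\<dots> \<le> (\<Sum>q\<in>{q \<in> T. c p q \<noteq> 0}. 2)"
    using assms(1) by (intro sum_mono) (simp add: cross_matrix_def)
  finally show ?thesis by simp
qed

text \<open>
  Each gadget is a row k that keeps a single entry of its support, so its row sum is that entry.
  The set K collects the indices that later gadgets must not delete.
\<close>

lemma gadgets:
  fixes c :: "'p \<Rightarrow> 'p \<Rightarrow> int"
  assumes c: "cross_matrix c" and P: "finite P"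
    and rows: "\<And>p. p \<in> P \<Longrightarrow> card {q \<in> P. c p q \<noteq> 0} \<le> D"
    and cols: "\<And>q. q \<in> P \<Longrightarrow> card {p \<in> P. c p q \<noteq> 0} \<le> C"
    and ij: "i \<in> P" "j \<in> P"
    and many: "n * D + (2 * n + 2) * (C + 1) + n * D * C < card {p \<in> P. \<exists>q\<in>P. c p q \<noteq> 0} + (D + 2 + 2 * C + D * C)"
  shows "\<exists>T K \<Omega>. T \<subseteq> P \<and> K \<subseteq> T \<and> i \<in> K \<and> j \<in> K \<and> card K \<le> 2 * n + 2 \<and>
    card (P - T) \<le> n * D \<and> \<Omega> \<subseteq> K - {i, j} \<and> card \<Omega> = n \<and>
    (\<forall>p\<in>\<Omega>. (\<forall>q\<in>T. c p q \<noteq> 0 \<longrightarrow> q \<in> K - {i, j}) \<and>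
       (\<bar>\<Sum>q\<in>T. c p q\<bar> = 1 \<or> \<bar>\<Sum>q\<in>T. c p q\<bar> = 2))"
  using many
proof (induction n)
  case 0
  then show ?case
    using ij by (intro exI[of _ P] exI[of _ "{i, j}"] exI[of _ "{}"]) (auto simp: card_insert_if)
next
  case (Suc n)
  let ?Z = "{p \<in> P. \<exists>q\<in>P. c p q \<noteq> 0}"
  \<comment> \<open>The slack in the hypothesis is exactly the increment of its left-hand side, so
    level \<open>Suc n\<close> yields the bound for \<open>n\<close> without slack, which the
    counting of \<open>B\<close> below consumes.\<close>
  have "n * D + (2 * n + 2) * (C + 1) + n * D * C + (D + 2 + 2 * C + D * C)
      = Suc n * D + (2 * Suc n + 2) * (C + 1) + Suc n * D * C"
    by (simp add: algebra_simps)
  then have big: "n * D + (2 * n + 2) * (C + 1) + n * D * C < card ?Z"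
    using Suc.prems by linarith
  then obtain T K \<Omega> where T: "T \<subseteq> P" "K \<subseteq> T" "i \<in> K" "j \<in> K" "card K \<le> 2 * n + 2"
      "card (P - T) \<le> n * D" and \<Omega>: "\<Omega> \<subseteq> K - {i, j}" "card \<Omega> = n"
      "\<And>p q. p \<in> \<Omega> \<Longrightarrow> q \<in> T \<Longrightarrow> c p q \<noteq> 0 \<Longrightarrow> q \<in> K - {i, j}"
      "\<And>p. p \<in> \<Omega> \<Longrightarrow> \<bar>\<Sum>q\<in>T. c p q\<bar> = 1 \<or> \<bar>\<Sum>q\<in>T. c p q\<bar> = 2"
    using Suc.IH by force
  have fin: "finite T" "finite K" "finite \<Omega>"
    using P T(1,2) \<Omega>(1) by (auto intro: rev_finite_subset)
  \<comment> \<open>\<open>B\<close> holds the rows that cannot be the next gadget: those deleted or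
    protected, and those with an entry in a deleted or protected column. A row outside
    \<open>B\<close> has its whole support in \<open>T - K\<close>, so thinning it out does not
    touch older gadgets.\<close>
  define B where "B = (P - T) \<union> K \<union> (\<Union>q\<in>K \<union> (P - T). {p \<in> P. c p q \<noteq> 0})"
  have "card (\<Union>q\<in>K \<union> (P - T). {p \<in> P. c p q \<noteq> 0}) \<le> (\<Sum>q\<in>K \<union> (P - T). card {p \<in> P. c p q \<noteq> 0})"
    using P fin by (intro card_UN_le) auto
  also have "\<dots> \<le> (\<Sum>q\<in>K \<union> (P - T). C)" using T(1,2) cols by (intro sum_mono) auto
  also have "\<dots> = card (K \<union> (P - T)) * C" by simp
  finally have "card B \<le> card (K \<union> (P - T)) + card (K \<union> (P - T)) * C"
    unfolding B_def by (intro order_trans[OF card_Un_le]) (simp add: Un_commute)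
  moreover have kt: "card (K \<union> (P - T)) \<le> (2 * n + 2) + n * D"
    using T(5,6) card_Un_le[of K "P - T"] by linarith
  ultimately have "card B \<le> ((2 * n + 2) + n * D) + ((2 * n + 2) + n * D) * C"
    by (meson add_mono mult_le_mono1 order_trans)
  also have "\<dots> < card ?Z" using big by (simp add: algebra_simps)
  finally have BZ: "card B < card ?Z" .
  have fB: "finite B" using P fin unfolding B_def by (intro finite_UnI finite_UN_I) simp_all
  have "\<not> ?Z \<subseteq> B"
    using BZ card_mono[OF fB, of ?Z] by linarith
  then obtain k q where k: "k \<in> P" "k \<notin> B" "q \<in> P" "c k q \<noteq> 0" by blast
  then have kT: "k \<in> T - K" and supp: "\<And>q'. q' \<in> P \<Longrightarrow> c k q' \<noteq> 0 \<Longrightarrow> q' \<in> T - K"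
    using T(1,2) by (auto simp: B_def)
  define X where "X = {q' \<in> T. c k q' \<noteq> 0} - {q}"
  have kk: "c k k = 0" using c by (simp add: cross_matrix_def)
  have qTK: "q \<in> T - K" using supp k by blast
  have XK: "X \<inter> K = {}" "X \<subseteq> T" "k \<notin> X" "q \<notin> X"
    using supp T(1) kk by (auto simp: X_def)
  have old: "(\<Sum>q\<in>T - X. c p q) = (\<Sum>q\<in>T. c p q)" if "p \<in> \<Omega>" for p
    using fin \<Omega>(3)[OF that] XK by (intro sum.mono_neutral_left) auto
  have "(\<Sum>q'\<in>T - X. c k q') = (\<Sum>q'\<in>{q}. c k q')"
    using fin qTK XK by (intro sum.mono_neutral_right) (auto simp: X_def)
  then have new: "(\<Sum>q'\<in>T - X. c k q') = c k q" by simp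
  have "\<bar>c k q\<bar> \<le> 2" using c by (simp add: cross_matrix_def)
  then have new12: "\<bar>\<Sum>q'\<in>T - X. c k q'\<bar> = 1 \<or> \<bar>\<Sum>q'\<in>T - X. c k q'\<bar> = 2"
    using new k(4) by linarith
  have "card X \<le> card {q \<in> P. c k q \<noteq> 0}"
    using P T(1) by (intro card_mono) (auto simp: X_def)
  then have "card X \<le> D" using rows[OF k(1)] by linarith
  moreover have "P - (T - X) = (P - T) \<union> X" using XK T(1) by auto
  ultimately have cX: "card (P - (T - X)) \<le> Suc n * D"
    using T(6) card_Un_le[of "P - T" X] by simp
  have kq: "k \<noteq> i" "k \<noteq> j" "q \<noteq> i" "q \<noteq> j" "k \<notin> \<Omega>" using kT qTK T(3,4) \<Omega>(1) by auto
  have "insert k \<Omega> \<subseteq> insert k (insert q K) - {i, j}" using \<Omega>(1) kq by auto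
  have "card (insert k (insert q K)) \<le> 2 * Suc n + 2"
    using T(5) fin by (simp add: card_insert_if)
  have "card (insert k \<Omega>) = Suc n" using kq fin \<Omega>(2) by simp
  have "insert k (insert q K) \<subseteq> T - X" using kT qTK T(2) XK by auto
  have "\<forall>p\<in>insert k \<Omega>. (\<forall>r\<in>T - X. c p r \<noteq> 0 \<longrightarrow> r \<in> insert k (insert q K) - {i, j}) \<and>
       (\<bar>\<Sum>q\<in>T - X. c p q\<bar> = 1 \<or> \<bar>\<Sum>q\<in>T - X. c p q\<bar> = 2)"
    using new12 old \<Omega>(3,4) kq by (auto simp: X_def)
  have "T - X \<subseteq> P" "i \<in> insert k (insert q K)" "j \<in> insert k (insert q K)"
    using T(1,3,4) by auto
  show ?case
    by (intro exI[of _ "T - X"] exI[of _ "insert k (insert q K)"] exI[of _ "insert k \<Omega>"] conjI) fact+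
qed

text \<open>The gadgets need bounded columns, so heavy columns are dropped first. If at most
  \<open>z\<close> nonzero rows remain, dropping them leaves a zero matrix; otherwise there is room
  for \<open>n\<close> gadgets at a cost of at most \<open>z\<close>. Gaps are at most 2D, so
  \<open>balanced_by_units\<close> asks for 12D gadgets. The multiplication by \<open>C\<close>
  avoids a division.\<close>

lemma balanced_small_rows:
  fixes c :: "'p \<Rightarrow> 'p \<Rightarrow> int" and C D :: nat
  assumes c: "cross_matrix c" and P: "finite P"
    and rows: "\<And>p. p \<in> P \<Longrightarrow> card {q \<in> P. c p q \<noteq> 0} \<le> D"
  defines "n \<equiv> 12 * D"
  defines "z \<equiv> n * D + (2 * n + 2) * (C + 1) + n * D * C"
  shows "\<exists>T\<subseteq>P. balanced c T \<and> C * card P \<le> C * card T + D * card P + C * z"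
proof -
  define H where "H = {q \<in> P. C < card {p \<in> P. c p q \<noteq> 0}}"
  define Q where "Q = P - H"
  have HC: "C * card H \<le> D * card P"
    unfolding H_def by (rule card_heavy_columns_le[OF P rows])
  have Q: "finite Q" "Q \<subseteq> P" and PQ: "card P = card Q + card H"
    using P by (auto simp: Q_def H_def card_Diff_subset card_mono)
  let ?Z = "{p \<in> Q. \<exists>q\<in>Q. c p q \<noteq> 0}"
  have goal: ?thesis if "T \<subseteq> Q" "balanced c T" "card Q \<le> card T + z" for T
  proof -
    have "C * card P = C * card Q + C * card H" using PQ by (simp add: algebra_simps)
    also have "\<dots> \<le> C * (card T + z) + D * card P"
      by (intro add_mono mult_le_mono HC that(3)) simp
    finally show ?thesis using that(1,2) Q(2) by (intro exI[of _ T]) (auto simp: algebra_simps)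
  qed
  have sub: "card {q \<in> S. f q} \<le> card {q \<in> P. f q}" if "S \<subseteq> P" for S f
    using P that by (intro card_mono) auto
  show ?thesis
  proof (cases "card ?Z \<le> z")
    case True
    have "balanced c (Q - ?Z)" by (rule balanced_if_zero) auto
    moreover have "card Q \<le> card (Q - ?Z) + z"
      using True Q(1) by (simp add: card_Diff_subset) 
    ultimately show ?thesis by (intro goal[of "Q - ?Z"]) auto
  next
    case False
    then have "?Z \<noteq> {}" by (metis card.empty le0)
    then obtain i j where ij: "i \<in> Q" "j \<in> Q" "c i j \<noteq> 0" by blast
    have rowsQ: "card {q \<in> Q. c p q \<noteq> 0} \<le> D" if "p \<in> Q" for p
      using rows[of p] sub[OF Q(2), of "\<lambda>q. c p q \<noteq> 0"] that Q(2) by (meson order_trans subsetD)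
    have "card {p \<in> P. c p q \<noteq> 0} \<le> C" if "q \<in> Q" for q
      using that by (auto simp: Q_def H_def)
    then have colsQ: "card {p \<in> Q. c p q \<noteq> 0} \<le> C" if "q \<in> Q" for q
      using sub[OF Q(2), of "\<lambda>p. c p q \<noteq> 0"] that by (meson order_trans)
    have "n * D + (2 * n + 2) * (C + 1) + n * D * C < card ?Z + (D + 2 + 2 * C + D * C)"
      using False unfolding z_def by linarith
    from gadgets[OF c Q(1) rowsQ colsQ ij(1,2) this]
    obtain T K \<Omega> where T: "T \<subseteq> Q" "K \<subseteq> T" "i \<in> K" "j \<in> K" "card (Q - T) \<le> n * D"
      and \<Omega>: "\<Omega> \<subseteq> K - {i, j}" "card \<Omega> = n"
      "\<And>p q. p \<in> \<Omega> \<Longrightarrow> q \<in> T \<Longrightarrow> c p q \<noteq> 0 \<Longrightarrow> q \<in> K - {i, j}"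
      "\<And>p. p \<in> \<Omega> \<Longrightarrow> \<bar>\<Sum>q\<in>T. c p q\<bar> = 1 \<or> \<bar>\<Sum>q\<in>T. c p q\<bar> = 2"
      by force
    have fT: "finite T" using Q(1) T(1) finite_subset by blast
    have small: "\<bar>\<Sum>q\<in>S. c p q\<bar> \<le> 2 * int D" if "S \<subseteq> Q" "p \<in> S" for S p
    proof -
      have "card {q \<in> S. c p q \<noteq> 0} \<le> D"
        using sub[of S "\<lambda>q. c p q \<noteq> 0"] that rows[of p] Q(2) by (meson order_trans subsetD)
      moreover have "finite S" using that(1) Q(1) finite_subset by blast
      ultimately show ?thesis using abs_row_sum_le[OF c, of S p] by linarith
    qed
    \<comment> \<open>The gadgets vanish at \<open>i\<close> and \<open>j\<close>, so these two can
      be taken out and handed to the switch.\<close>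
    define T' where "T' = T - {i, j}"
    have zero: "c p i = 0" "c p j = 0" if "p \<in> \<Omega>" for p
      using \<Omega>(3)[OF that] T(2-4) by auto
    have same: "(\<Sum>q\<in>T'. c p q) = (\<Sum>q\<in>T. c p q)" if "p \<in> \<Omega>" for p
      unfolding T'_def using fT zero[OF that] by (intro sum.mono_neutral_left) auto
    have "\<exists>D'\<subseteq>{i, j}. balanced c (T' \<union> D')"
    proof (rule balanced_by_units[OF c, where \<Gamma> = "2 * int D" and \<Omega> = \<Omega>])
      show "\<bar>\<Sum>q\<in>T' \<union> D'. c p q\<bar> \<le> 2 * int D" if "D' \<subseteq> {i, j}" "p \<in> T' \<union> D'" for D' p
        using that T ij by (intro small) (auto simp: T'_def)
    qed (use fT ij \<Omega> T(2) zero same in \<open>auto simp: T'_def n_def\<close>)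
    then obtain D' where D': "D' \<subseteq> {i, j}" "balanced c (T' \<union> D')" by blast
    have "card Q \<le> card (T' \<union> D') + z"
    proof -
      have "card Q = card T + card (Q - T)"
        using T(1) Q(1) fT by (simp add: card_Diff_subset card_mono)
      also have "card T \<le> card T' + 2"
        using diff_card_le_card_Diff[of "{i, j}" T] card_insert_le_m1[of 2 "{j}" i] by (simp add: T'_def)
      also have "card T' \<le> card (T' \<union> D')"
        using fT D'(1) by (intro card_mono) (auto simp: T'_def intro: finite_subset)
      finally show ?thesis using T(5) unfolding z_def by simp
    qed
    then show ?thesis using D' T(1) ij by (intro goal[of "T' \<union> D'"]) (auto simp: T'_def)
  qed
qed

section \<open>Random deletion\<close>

text \<open>Deleting \<open>t\<close> entries of one common value \<open>v\<close> changes the sum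
  by exactly \<open>v * t\<close>, so every \<open>t\<close>-subset of \<open>B\<close> works and a
  random deletion has many chances. From a gap of at least 3, entries 1 are removed until 1 remains,
  or entries 2 until 1 or 2 remains; one of these two values is then a fixed share of the
  support.\<close>

lemma row_tuning_nonneg:
  fixes r :: "'p \<Rightarrow> int"
  assumes U: "finite U" and r: "\<And>q. \<bar>r q\<bar> \<le> 2" and s: "s \<le> card {q \<in> U. r q \<noteq> 0}"
    and g: "0 \<le> (\<Sum>q\<in>U. r q)" "(\<Sum>q\<in>U. r q) \<le> int K" and "K \<ge> 1"
  shows "\<exists>B t. B \<subseteq> {q \<in> U. r q \<noteq> 0} \<and> s \<le> 8 * card B \<and> t \<le> K \<and>
    (\<forall>Y\<subseteq>B. card Y = t \<longrightarrow> \<bar>\<Sum>q\<in>U - Y. r q\<bar> = 1 \<or> \<bar>\<Sum>q\<in>U - Y. r q\<bar> = 2)"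
proof -
  define E where "E v = {q \<in> U. r q = v}" for v
  let ?g = "\<Sum>q\<in>U. r q"
  have ind: "(\<Sum>q\<in>U. of_bool (r q = v)) = int (card (E v))" for v
    using U by (simp add: E_def Int_def)
  have cases: "r q = 0 \<or> r q = 1 \<or> r q = 2 \<or> r q = -1 \<or> r q = -2" for q
    using r[of q] by linarith
  have "?g = (\<Sum>q\<in>U. of_bool (r q = 1) + 2 * of_bool (r q = 2) - of_bool (r q = -1) - 2 * of_bool (r q = -2))"
  proof (rule sum.cong)
    fix q show "r q = of_bool (r q = 1) + 2 * of_bool (r q = 2) - of_bool (r q = -1) - 2 * of_bool (r q = -2)"
      using cases[of q] by (elim disjE) simp_all
  qed simp
  also have "\<dots> = int (card (E 1)) + 2 * int (card (E 2)) - int (card (E (-1))) - 2 * int (card (E (-2)))"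
    by (simp only: sum.distrib sum_subtractf sum_distrib_left[symmetric] ind)
  finally have g_eq: "?g = int (card (E 1)) + 2 * int (card (E 2)) - int (card (E (-1))) - 2 * int (card (E (-2)))" .
  have "int (card {q \<in> U. r q \<noteq> 0}) = (\<Sum>q\<in>U. of_bool (r q \<noteq> 0))"
    using U by (simp add: Int_def)
  also have "\<dots> = (\<Sum>q\<in>U. of_bool (r q = 1) + of_bool (r q = 2) + of_bool (r q = -1) + of_bool (r q = -2))"
  proof (rule sum.cong)
    fix q show "of_bool (r q \<noteq> 0) = (of_bool (r q = 1) + of_bool (r q = 2) + of_bool (r q = -1) + of_bool (r q = -2) :: int)"
      using cases[of q] by (elim disjE) simp_all
  qed simp
  also have "\<dots> = int (card (E 1)) + int (card (E 2)) + int (card (E (-1))) + int (card (E (-2)))"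
    by (simp only: sum.distrib ind)
  finally have s_le: "int s \<le> card (E 1) + card (E 2) + card (E (-1)) + card (E (-2))"
    using s by simp
  have del: "(\<Sum>q\<in>U - Y. r q) = ?g - v * int (card Y)" if "Y \<subseteq> E v" for Y v
  proof -
    have "Y \<subseteq> U" using that by (auto simp: E_def)
    have "(\<Sum>q\<in>Y. r q) = (\<Sum>q\<in>Y. v)" using that by (intro sum.cong) (auto simp: E_def)
    then show ?thesis using sum_diff[OF U \<open>Y \<subseteq> U\<close>, of r] by simp
  qed
  have use: ?thesis if "v \<noteq> 0" "s \<le> 8 * card (E v)" "t \<le> K" "\<bar>?g - v * int t\<bar> = 1 \<or> \<bar>?g - v * int t\<bar> = 2" for v t
  proof (intro exI[of _ "E v"] exI[of _ t] conjI allI impI)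
    fix Y assume "Y \<subseteq> E v" "card Y = t"
    then show "\<bar>\<Sum>q\<in>U - Y. r q\<bar> = 1 \<or> \<bar>\<Sum>q\<in>U - Y. r q\<bar> = 2" using del that(4) by simp
  qed (use that in \<open>auto simp: E_def\<close>)
  consider "?g = 0" | "?g = 1 \<or> ?g = 2" | "?g \<ge> 3" using g(1) by linarith
  then show ?thesis
  proof cases
    case 1
    \<comment> \<open>A zero gap becomes 1 or 2 when one negative entry goes. As positive and
      negative entries cancel, one of the negative values is a fixed share of the support.\<close>
    have "int s \<le> 8 * card (E (-1)) \<or> int s \<le> 8 * card (E (-2))"
      using s_le g_eq 1 by linarith
    then show ?thesis
      using use[of "-1" 1] use[of "-2" 1] 1 \<open>K \<ge> 1\<close> by auto
  next
    case 2
    have "\<bar>\<Sum>q\<in>U - Y. r q\<bar> = 1 \<or> \<bar>\<Sum>q\<in>U - Y. r q\<bar> = 2" if "Y \<subseteq> {q \<in> U. r q \<noteq> 0}" "card Y = 0" for Y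
    proof -
      have "finite Y" using U that(1) by (rule_tac finite_subset) auto
      then show ?thesis using that 2 by auto
    qed
    then show ?thesis using s by (intro exI[of _ "{q \<in> U. r q \<noteq> 0}"] exI[of _ 0]) auto
  next
    case 3
    have "int s \<le> 8 * card (E 1) \<or> int s \<le> 8 * card (E 2)"
      using s_le g_eq 3 by linarith
    moreover have "?g - 2 * int (nat ((?g - 1) div 2)) = 1 \<or> ?g - 2 * int (nat ((?g - 1) div 2)) = 2"
      using 3 by (simp, presburger)
    moreover have "nat ((?g - 1) div 2) \<le> K" "nat (?g - 1) \<le> K" using g(2) 3 by linarith+
    ultimately show ?thesis
      using use[of 1 "nat (?g - 1)"] use[of 2 "nat ((?g - 1) div 2)"] 3 by auto
  qed
qed

lemma row_tuning:
  fixes r :: "'p \<Rightarrow> int"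
  assumes U: "finite U" and r: "\<And>q. \<bar>r q\<bar> \<le> 2" and s: "s \<le> card {q \<in> U. r q \<noteq> 0}"
    and g: "\<bar>\<Sum>q\<in>U. r q\<bar> \<le> int K" and K: "K \<ge> 1"
  shows "\<exists>B t. B \<subseteq> {q \<in> U. r q \<noteq> 0} \<and> s \<le> 8 * card B \<and> t \<le> K \<and>
    (\<forall>Y\<subseteq>B. card Y = t \<longrightarrow> \<bar>\<Sum>q\<in>U - Y. r q\<bar> = 1 \<or> \<bar>\<Sum>q\<in>U - Y. r q\<bar> = 2)"
proof (cases "0 \<le> (\<Sum>q\<in>U. r q)")
  case True
  then show ?thesis using row_tuning_nonneg[OF U r s True _ K] g by simp
next
  case False
  then show ?thesis
    using row_tuning_nonneg[OF U, of "\<lambda>q. - r q" s K] r s g K by (simp add: sum_negf)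
qed

section \<open>Random subsets with independently chosen elements, as weights on the power
  set\<close>

definition subset_prob :: "real \<Rightarrow> 'p set \<Rightarrow> 'p set \<Rightarrow> real" where
  "subset_prob p U X = p ^ card X * (1 - p) ^ card (U - X)"

lemma subset_prob_nonneg: "0 \<le> p \<Longrightarrow> p \<le> 1 \<Longrightarrow> 0 \<le> subset_prob p U X"
  by (simp add: subset_prob_def)

lemma sum_subset_prob: "finite U \<Longrightarrow> (\<Sum>X\<in>Pow U. subset_prob p U X) = 1"
  using prod_add[of U "\<lambda>_. p" "\<lambda>_. 1 - p"] by (simp add: subset_prob_def)

text \<open>The choices outside \<open>S\<close> are independent of the trace on \<open>S\<close>,
  and their weights sum to 1.\<close>

lemma sum_subset_prob_trace:
  assumes U: "finite U" and "Y \<subseteq> S" "S \<subseteq> U"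
  shows "(\<Sum>X | X \<subseteq> U \<and> X \<inter> S = Y. subset_prob p U X) = p ^ card Y * (1 - p) ^ card (S - Y)"
proof -
  have fin: "finite S" "finite Y"
    using finite_subset[OF assms(3) U] finite_subset[OF assms(2)] by auto
  have "{X. X \<subseteq> U \<and> X \<inter> S = Y} = (\<lambda>X. Y \<union> X) ` Pow (U - S)"
  proof (intro equalityI subsetI)
    fix X assume "X \<in> {X. X \<subseteq> U \<and> X \<inter> S = Y}"
    then have "X = Y \<union> (X - S)" "X - S \<in> Pow (U - S)" by auto
    then show "X \<in> (\<lambda>X. Y \<union> X) ` Pow (U - S)" by blast
  qed (use assms in auto)
  moreover have "inj_on (\<lambda>X. Y \<union> X) (Pow (U - S))"
    using assms(2) by (intro inj_onI) blast
  ultimately have "(\<Sum>X | X \<subseteq> U \<and> X \<inter> S = Y. subset_prob p U X) = (\<Sum>X\<in>Pow (U - S). subset_prob p U (Y \<union> X))"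
    by (simp add: sum.reindex)
  also have "\<dots> = (\<Sum>X\<in>Pow (U - S). p ^ card Y * (1 - p) ^ card (S - Y) * subset_prob p (U - S) X)"
  proof (rule sum.cong)
    fix X assume X: "X \<in> Pow (U - S)"
    have fX: "finite X" using X U by (auto intro: finite_subset)
    have "card (Y \<union> X) = card Y + card X"
      using X assms(2) fin fX by (intro card_Un_disjoint) auto
    moreover have "U - (Y \<union> X) = (S - Y) \<union> (U - S - X)" using X assms(2,3) by auto
    moreover have "card ((S - Y) \<union> (U - S - X)) = card (S - Y) + card (U - S - X)"
      using fin U by (intro card_Un_disjoint) auto
    ultimately show "subset_prob p U (Y \<union> X)
        = p ^ card Y * (1 - p) ^ card (S - Y) * subset_prob p (U - S) X"
      by (simp add: subset_prob_def power_add)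
  qed simp
  also have "\<dots> = p ^ card Y * (1 - p) ^ card (S - Y)"
    using U sum_subset_prob[of "U - S" p] by (simp add: sum_distrib_left[symmetric])
  finally show ?thesis .
qed

lemma expected_card_subset:
  assumes "finite U"
  shows "(\<Sum>X\<in>Pow U. subset_prob p U X * card X) = p * card U"
proof -
  have "(\<Sum>X\<in>Pow U. subset_prob p U X * card X) = (\<Sum>X\<in>Pow U. \<Sum>x\<in>U. subset_prob p U X * of_bool (x \<in> X))"
  proof (rule sum.cong)
    fix X assume "X \<in> Pow U"
    then have "real (card X) = (\<Sum>x\<in>U. of_bool (x \<in> X))"
      using assms by (simp add: Int_absorb1 Int_def[symmetric])
    then show "subset_prob p U X * card X = (\<Sum>x\<in>U. subset_prob p U X * of_bool (x \<in> X))"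
      by (simp only: sum_distrib_left)
  qed simp
  also have "\<dots> = (\<Sum>x\<in>U. \<Sum>X\<in>Pow U. subset_prob p U X * of_bool (x \<in> X))" by (rule sum.swap)
  also have "\<dots> = (\<Sum>x\<in>U. p)"
  proof (rule sum.cong)
    fix x assume x: "x \<in> U"
    have "(\<Sum>X\<in>Pow U. subset_prob p U X * of_bool (x \<in> X)) = (\<Sum>X | X \<subseteq> U \<and> X \<inter> {x} = {x}. subset_prob p U X)"
      using assms by (intro sum.mono_neutral_cong_right) auto
    then show "(\<Sum>X\<in>Pow U. subset_prob p U X * of_bool (x \<in> X)) = p"
      using sum_subset_prob_trace[OF assms, of "{x}" "{x}" p] x by simp
  qed simp
  finally show ?thesis by simp
qed

definition unit_row :: "('p \<Rightarrow> 'p \<Rightarrow> int) \<Rightarrow> 'p set \<Rightarrow> 'p \<Rightarrow> bool" where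
  "unit_row c T k \<longleftrightarrow> k \<in> T \<and> (\<bar>\<Sum>q\<in>T. c k q\<bar> = 1 \<or> \<bar>\<Sum>q\<in>T. c k q\<bar> = 2)"

text \<open>It suffices that the deleted set meets \<open>S\<close>, the support together with
  \<open>k\<close>, in a \<open>t\<close>-subset of \<open>B\<close>. With p = 1/(4s), sparing the
  rest of \<open>S\<close> has probability at least 1 - 2sp = 1/2 by Bernoulli's inequality. The
  number of \<open>t\<close>-subsets times p^t is at least (|B| p / t)^t, and |B| >= s/8 and t <= K
  leave a bound in terms of \<open>K\<close> alone.\<close>

lemma unit_row_prob:
  fixes c :: "'p \<Rightarrow> 'p \<Rightarrow> int"
  assumes c: "cross_matrix c" and U: "finite U" "k \<in> U"
    and s: "1 \<le> s" "8 * K \<le> s" "s \<le> card {q \<in> U. c k q \<noteq> 0}" "card {q \<in> U. c k q \<noteq> 0} < 2 * s"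
    and gap: "\<bar>\<Sum>q\<in>U. c k q\<bar> \<le> int K" and K: "K \<ge> 1"
  shows "(\<Sum>X | X \<subseteq> U \<and> unit_row c (U - X) k. subset_prob (1 / (4 * real s)) U X) \<ge> (1 / (32 * real K)) ^ K / 2"
proof -
  have c2: "\<bar>c k q\<bar> \<le> 2" and ckk: "c k k = 0" for q using c by (auto simp: cross_matrix_def)
  obtain B t where B: "B \<subseteq> {q \<in> U. c k q \<noteq> 0}" "s \<le> 8 * card B" "t \<le> K"
    and good: "\<And>Y. Y \<subseteq> B \<Longrightarrow> card Y = t \<Longrightarrow> \<bar>\<Sum>q\<in>U - Y. c k q\<bar> = 1 \<or> \<bar>\<Sum>q\<in>U - Y. c k q\<bar> = 2"
    using row_tuning[OF U(1) c2 s(3) gap K] by blast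
  define S where "S = insert k {q \<in> U. c k q \<noteq> 0}"
  define p where "p = 1 / (4 * real s)"
  have p: "0 \<le> p" "p \<le> 1" using s(1) by (auto simp: p_def divide_simps)
  have SU: "S \<subseteq> U" "finite S" and BS: "B \<subseteq> S" "finite B"
    using U B(1) by (auto simp: S_def intro: finite_subset)
  \<comment> \<open>The strict bound on the support leaves room for \<open>k\<close> itself.\<close>
  have cardS: "card S \<le> 2 * s" using s(4) U(1) by (simp add: S_def ckk)
  let ?Ys = "{Y. Y \<subseteq> B \<and> card Y = t}"
  let ?F = "\<lambda>Y. {X. X \<subseteq> U \<and> X \<inter> S = Y}"
  have finF: "finite (?F Y)" for Y using U(1) by simp
  have sub: "(\<Union>Y\<in>?Ys. ?F Y) \<subseteq> {X. X \<subseteq> U \<and> unit_row c (U - X) k}"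
  proof
    fix X assume "X \<in> (\<Union>Y\<in>?Ys. ?F Y)"
    then have X: "X \<subseteq> U" "X \<inter> S \<subseteq> B" "card (X \<inter> S) = t" by auto
    have "(\<Sum>q\<in>U - X. c k q) = (\<Sum>q\<in>U - X \<inter> S. c k q)"
      using U(1) X(1) by (intro sum.mono_neutral_left) (auto simp: S_def)
    moreover have "k \<notin> X" using X(2) B(1) ckk by (auto simp: S_def)
    ultimately show "X \<in> {X. X \<subseteq> U \<and> unit_row c (U - X) k}"
      using good[OF X(2,3)] X(1) U(2) by (auto simp: unit_row_def)
  qed
  have "1 - real (2 * s) * p \<le> (1 - p) ^ (2 * s)"
    using Bernoulli_inequality[of "- p" "2 * s"] p by simp
  then have half: "1 / 2 \<le> (1 - p) ^ (2 * s)" using s(1) by (simp add: p_def)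
  have binom: "(1 / (32 * real K)) ^ K \<le> real (card B choose t) * p ^ t"
  proof (cases "t = 0")
    case True
    moreover have "(1 / (32 * real K)) ^ K \<le> 1" using K by (intro power_le_one) auto
    ultimately show ?thesis by simp
  next
    case False
    have "t \<le> card B" using B(2,3) s(2) by linarith
    have "(1 / (32 * real K)) ^ K \<le> (1 / (32 * real K)) ^ t"
      using K B(3) by (intro power_decreasing) (auto simp: divide_simps)
    also have "\<dots> \<le> (real (card B) / real t * p) ^ t"
    proof (rule power_mono)
      have "real s * real t \<le> (8 * real (card B)) * real K"
        using B(2,3) by (intro mult_mono) auto
      then show "1 / (32 * real K) \<le> real (card B) / real t * p"
        using False s(1) K by (simp add: p_def field_simps)
    qed (use K in simp)
    also have "\<dots> = (real (card B) / real t) ^ t * p ^ t" by (rule power_mult_distrib)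
    also have "\<dots> \<le> real (card B choose t) * p ^ t"
      using binomial_ge_n_over_k_pow_k[OF \<open>t \<le> card B\<close>, where ?'a = real] p by (intro mult_right_mono) auto
    finally show ?thesis .
  qed
  have "(1 / (32 * real K)) ^ K / 2 \<le> (real (card B choose t) * p ^ t) * (1 - p) ^ (2 * s)"
    using mult_mono[OF binom half] p by simp
  also have "\<dots> = (\<Sum>Y\<in>?Ys. p ^ t * (1 - p) ^ (2 * s))"
    using n_subsets[OF BS(2), of t] by simp
  also have "\<dots> \<le> (\<Sum>Y\<in>?Ys. \<Sum>X\<in>?F Y. subset_prob p U X)"
  proof (rule sum_mono)
    fix Y assume Y: "Y \<in> ?Ys"
    have "card (S - Y) \<le> 2 * s" using cardS card_mono[OF SU(2), of "S - Y"] by simp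
    then have "(1 - p) ^ (2 * s) \<le> (1 - p) ^ card (S - Y)" using p by (intro power_decreasing) auto
    then show "p ^ t * (1 - p) ^ (2 * s) \<le> (\<Sum>X\<in>?F Y. subset_prob p U X)"
      using sum_subset_prob_trace[OF U(1) _ SU(1), of Y p] Y BS(1) p
      by (auto intro!: mult_left_mono)
  qed
  also have "\<dots> = (\<Sum>X\<in>(\<Union>Y\<in>?Ys. ?F Y). subset_prob p U X)"
    using finF BS(2) by (intro sum.UNION_disjoint[symmetric]) auto
  also have "\<dots> \<le> (\<Sum>X | X \<subseteq> U \<and> unit_row c (U - X) k. subset_prob p U X)"
    using U(1) sub p by (intro sum_mono2 subset_prob_nonneg) auto
  finally show ?thesis by (simp add: p_def)
qed

text \<open>One average controls two quantities. The weight \<open>\<mu>\<close> makes the mean of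
  \<mu>|X| half of the lower bound for the mean number of unit rows. A set \<open>X\<close> for
  which the difference of the two reaches the other half has many unit rows; also \<mu>|X| is at
  most their number, hence at most |F|.\<close>

lemma exists_tuning_deletion:
  fixes c :: "'p \<Rightarrow> 'p \<Rightarrow> int"
  assumes c: "cross_matrix c" and U: "finite U" and F: "F \<subseteq> U" "F \<noteq> {}"
    and s: "1 \<le> s" "8 * K \<le> s" and K: "K \<ge> 1"
    and rows: "\<And>k. k \<in> F \<Longrightarrow> s \<le> card {q \<in> U. c k q \<noteq> 0}"
      "\<And>k. k \<in> F \<Longrightarrow> card {q \<in> U. c k q \<noteq> 0} < 2 * s"
      "\<And>k. k \<in> F \<Longrightarrow> \<bar>\<Sum>q\<in>U. c k q\<bar> \<le> int K"
  defines "a \<equiv> (1 / (32 * real K)) ^ K / 2"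
  shows "\<exists>X\<subseteq>U. a * real (card F) / 2 \<le> real (card {k \<in> F. unit_row c (U - X) k}) \<and>
    real (card X) \<le> real (card U) / (2 * a * real s)"
proof -
  define p where "p = 1 / (4 * real s)"
  have p: "0 < p" "p \<le> 1" using s(1) by (auto simp: p_def divide_simps)
  have a: "0 < a" using K by (simp add: a_def)
  have fF: "finite F" and M: "card F > 0" and UM: "card U > 0"
    using F U by (auto simp: card_gt_0_iff intro: finite_subset)
  define \<mu> where "\<mu> = a * real (card F) / (2 * p * real (card U))"
  have \<mu>: "\<mu> > 0" using a M UM p by (simp add: \<mu>_def)
  let ?P = "\<lambda>X. subset_prob p U X"
  let ?N = "\<lambda>X. real (card {k \<in> F. unit_row c (U - X) k})"
  have "real (card F) * a = (\<Sum>k\<in>F. a)" by simp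
  also have "\<dots> \<le> (\<Sum>k\<in>F. \<Sum>X | X \<subseteq> U \<and> unit_row c (U - X) k. ?P X)"
    unfolding a_def p_def
    by (intro sum_mono unit_row_prob[OF c U] s K rows) (use F in auto)
  also have "\<dots> = (\<Sum>k\<in>F. \<Sum>X\<in>Pow U. ?P X * of_bool (unit_row c (U - X) k))"
    using U by (intro sum.cong sum.mono_neutral_cong_left) auto
  also have "\<dots> = (\<Sum>X\<in>Pow U. \<Sum>k\<in>F. ?P X * of_bool (unit_row c (U - X) k))" by (rule sum.swap)
  also have "\<dots> = (\<Sum>X\<in>Pow U. ?P X * ?N X)"
    using fF by (simp add: sum_distrib_left[symmetric] Int_def)
  finally have EN: "a * real (card F) \<le> (\<Sum>X\<in>Pow U. ?P X * ?N X)"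
    by (simp only: mult.commute)
  have EX: "(\<Sum>X\<in>Pow U. ?P X * (\<mu> * card X)) = a * card F / 2"
  proof -
    have "(\<Sum>X\<in>Pow U. ?P X * (\<mu> * card X)) = \<mu> * (\<Sum>X\<in>Pow U. ?P X * card X)"
      by (simp add: sum_distrib_left algebra_simps)
    also have "\<dots> = \<mu> * (p * card U)" using expected_card_subset[OF U, of p] by simp
    also have "\<dots> = a * card F / 2" using p UM by (simp add: \<mu>_def)
    finally show ?thesis .
  qed
  have "\<exists>X\<in>Pow U. a * card F / 2 \<le> ?N X - \<mu> * card X"
  proof (rule ccontr)
    assume neg: "\<not> ?thesis"
    have nn: "0 \<le> ?P X" for X using p by (intro subset_prob_nonneg) auto
    have "0 < ?P {}" using s(1) by (simp add: subset_prob_def p_def divide_simps)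
    moreover have neg': "?N X - \<mu> * card X < a * card F / 2" if "X \<in> Pow U" for X
      using neg that by (simp add: not_le)
    ultimately have "(\<Sum>X\<in>Pow U. ?P X * (?N X - \<mu> * card X)) < (\<Sum>X\<in>Pow U. ?P X * (a * card F / 2))"
      using U by (intro sum_strict_mono_ex1 ballI bexI[of _ "{}"] mult_left_mono mult_strict_left_mono
        nn neg' less_imp_le[OF neg']) auto
    also have "\<dots> = a * card F / 2"
      using sum_subset_prob[OF U, of p] by (simp only: sum_distrib_right[symmetric])
    finally show False
      using EN EX by (simp add: right_diff_distrib sum_subtractf)
  qed
  then obtain X where X: "X \<subseteq> U" "a * card F / 2 \<le> ?N X - \<mu> * card X" by blast
  have "?N X \<le> card F" using fF by (auto intro: card_mono)
  moreover have "0 \<le> a * card F" using a by simp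
  ultimately have "\<mu> * card X \<le> card F" using X(2) by linarith
  then have "card X \<le> card F / \<mu>" using \<mu> by (simp add: field_simps)
  also have "\<dots> = 2 * p * card U / a" using M UM a p by (simp add: \<mu>_def)
  also have "\<dots> = card U / (2 * a * s)" using s(1) a by (simp add: p_def field_simps)
  finally have "card X \<le> card U / (2 * a * s)" .
  moreover have "0 \<le> \<mu> * card X" using \<mu> by simp
  ultimately show ?thesis using X by (intro exI[of _ X] conjI) linarith+
qed

lemma abs_sum_diff_le:
  fixes c :: "'p \<Rightarrow> 'p \<Rightarrow> int"
  assumes c: "cross_matrix c" and "finite W" "T \<subseteq> W"
  shows "\<bar>\<Sum>q\<in>T. c p q\<bar> \<le> \<bar>\<Sum>q\<in>W. c p q\<bar> + 2 * int (card (W - T))"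
proof -
  have "(\<Sum>q\<in>W. c p q) = (\<Sum>q\<in>W - T. c p q) + (\<Sum>q\<in>T. c p q)"
    using assms by (intro sum.subset_diff) auto
  moreover have "\<bar>\<Sum>q\<in>W - T. c p q\<bar> \<le> (\<Sum>q\<in>W - T. 2)"
    using c by (intro order_trans[OF sum_abs] sum_mono) (simp add: cross_matrix_def)
  ultimately show ?thesis by simp
qed

text \<open>Grouping by the binary logarithm of \<open>\<rho>\<close> gives at most
  \<open>floor_log m + 1\<close> groups. A common scale is needed because one deletion probability,
  of order 1/s, has to suit all rows considered.\<close>

lemma dyadic_pigeonhole:
  fixes \<rho> :: "'p \<Rightarrow> nat"
  assumes "finite B" "\<And>k. k \<in> B \<Longrightarrow> 1 \<le> \<rho> k \<and> \<rho> k \<le> m"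
  shows "\<exists>s. card B \<le> (floor_log m + 1) * card {k \<in> B. s \<le> \<rho> k \<and> \<rho> k < 2 * s}"
proof (rule ccontr)
  let ?F = "\<lambda>l. {k \<in> B. floor_log (\<rho> k) = l}"
  have F: "?F l \<subseteq> {k \<in> B. 2 ^ l \<le> \<rho> k \<and> \<rho> k < 2 * 2 ^ l}" for l
    using assms(2) floor_log_exp2_le floor_log_exp2_gt by fastforce
  assume neg: "\<not> ?thesis"
  have small: "(floor_log m + 1) * card (?F l) < card B" for l
  proof -
    have "card (?F l) \<le> card {k \<in> B. 2 ^ l \<le> \<rho> k \<and> \<rho> k < 2 * 2 ^ l}"
      using F assms(1) by (intro card_mono) auto
    then have "(floor_log m + 1) * card (?F l)
        \<le> (floor_log m + 1) * card {k \<in> B. 2 ^ l \<le> \<rho> k \<and> \<rho> k < 2 * 2 ^ l}"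
      by (rule mult_le_mono2)
    also have "\<dots> < card B" using neg by (simp only: not_ex not_le)
    finally show ?thesis .
  qed
  have "B = (\<Union>l\<in>{..floor_log m}. ?F l)"
    using assms(2) by (auto intro: floor_log_le_iff)
  also have "card \<dots> \<le> (\<Sum>l\<le>floor_log m. card (?F l))"
    by (rule card_UN_le) simp
  finally have "card B \<le> (\<Sum>l\<le>floor_log m. card (?F l))" .
  then have "(floor_log m + 1) * card B \<le> (\<Sum>l\<le>floor_log m. (floor_log m + 1) * card (?F l))"
    by (metis mult_le_mono2 sum_distrib_left)
  also have "\<dots> < (\<Sum>l\<le>floor_log m. card B)" using small by (intro sum_strict_mono) auto
  finally show False by simp
qed

text \<open>The rows of \<open>B\<close> are restricted to a popular scale \<open>s\<close> of
  support size. As \<open>s\<close> exceeds D/2, the random deletion costs at most |U|/(aD) pairs.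
  It turns a share a/2 of the selected rows into units, and \<open>many\<close> says that these
  number at least six times the enlarged bound on gaps.\<close>

lemma balanced_large_rows:
  fixes c :: "'p \<Rightarrow> 'p \<Rightarrow> int"
  assumes c: "cross_matrix c" and U: "finite U" and ij: "i \<notin> U" "j \<notin> U" "c i j \<noteq> 0"
    and zero: "\<And>k. k \<in> U \<Longrightarrow> c k i = 0 \<and> c k j = 0"
    and gap: "\<And>p. p \<in> U \<union> {i, j} \<Longrightarrow> \<bar>\<Sum>q\<in>U \<union> {i, j}. c p q\<bar> \<le> \<Gamma>" and \<Gamma>: "0 \<le> \<Gamma>"
    and K: "1 \<le> K" "16 * K \<le> D"
    and B: "B \<subseteq> U" "\<And>k. k \<in> B \<Longrightarrow> D < card {q \<in> U. c k q \<noteq> 0}"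
      "\<And>k. k \<in> B \<Longrightarrow> \<bar>\<Sum>q\<in>U. c k q\<bar> \<le> int K"
  defines "a \<equiv> (1 / (32 * real K)) ^ K / 2"
  assumes many: "6 * (of_int \<Gamma> + 2 * (real (card U) / (a * real D)) + 4)
      \<le> a * real (card B) / (2 * real (floor_log (card U) + 1))"
  shows "\<exists>T\<subseteq>U \<union> {i, j}. balanced c T \<and> real (card U) \<le> real (card T) + real (card U) / (a * real D)"
proof -
  have a: "0 < a" using K by (simp add: a_def)
  let ?\<rho> = "\<lambda>k. card {q \<in> U. c k q \<noteq> 0}"
  have fB: "finite B" using U B(1) finite_subset by blast
  have "1 \<le> ?\<rho> k \<and> ?\<rho> k \<le> card U" if "k \<in> B" for k
    using B(2)[OF that] U by (auto intro: card_mono)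
  then obtain s where s: "card B \<le> (floor_log (card U) + 1) * card {k \<in> B. s \<le> ?\<rho> k \<and> ?\<rho> k < 2 * s}"
    using dyadic_pigeonhole[OF fB, of ?\<rho> "card U"] by blast
  define F where "F = {k \<in> B. s \<le> ?\<rho> k \<and> ?\<rho> k < 2 * s}"
  have s': "real (card B) / real (floor_log (card U) + 1) \<le> real (card F)"
    using s unfolding F_def[symmetric]
    by (simp only: pos_divide_le_eq of_nat_0_less_iff) (metis mult.commute of_nat_le_iff of_nat_mult)
  have "0 < 6 * (of_int \<Gamma> + 2 * (real (card U) / (a * real D)) + 4)"
    using \<Gamma> a by (simp add: add_nonneg_pos)
  then have "0 < a * real (card B) / (2 * real (floor_log (card U) + 1))" using many by linarith
  then have "card B \<noteq> 0" by (intro notI) simp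
  then have "card F \<noteq> 0" using s unfolding F_def by (intro notI) simp
  then have "F \<noteq> {}" by auto
  then obtain k where k: "k \<in> F" by blast
  then have Ds: "D < 2 * s" using B(2)[of k] by (auto simp: F_def)
  have "\<exists>X\<subseteq>U. a * real (card F) / 2 \<le> real (card {k \<in> F. unit_row c (U - X) k}) \<and>
    real (card X) \<le> real (card U) / (2 * a * real s)"
    unfolding a_def
    by (rule exists_tuning_deletion[OF c U])
      (use B Ds K \<open>F \<noteq> {}\<close> in \<open>auto simp: F_def\<close>)
  then obtain X where X: "X \<subseteq> U" "a * real (card F) / 2 \<le> real (card {k \<in> F. unit_row c (U - X) k})"
    "real (card X) \<le> real (card U) / (2 * a * real s)" by blast
  have "real (card U) / (2 * a * real s) \<le> real (card U) / (a * real D)"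
    using a Ds K by (intro divide_left_mono) (auto simp: mult_le_cancel_left)
  then have X': "real (card X) \<le> real (card U) / (a * real D)" using X(3) by linarith
  define \<Omega> where "\<Omega> = {k \<in> F. unit_row c (U - X) k}"
  \<comment> \<open>Each missing pair moves a gap by at most 2; besides \<open>X\<close>, the pairs
    \<open>i\<close> and \<open>j\<close> may be missing.\<close>
  define \<Gamma>' where "\<Gamma>' = \<Gamma> + 2 * (int (card X) + 2)"
  have "6 * real_of_int \<Gamma>' \<le> 6 * (of_int \<Gamma> + 2 * (real (card U) / (a * real D)) + 4)"
    using X' by (simp add: \<Gamma>'_def)
  also have "\<dots> \<le> a * (real (card B) / real (floor_log (card U) + 1)) / 2"
    using many by (simp only: times_divide_eq_right divide_divide_eq_left mult.commute[of 2])
  also have "\<dots> \<le> a * real (card F) / 2" using s' a by (intro divide_right_mono mult_left_mono) auto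
  also have "\<dots> \<le> real (card \<Omega>)" using X(2) by (simp add: \<Omega>_def)
  finally have "real_of_int (6 * \<Gamma>') \<le> real_of_int (int (card \<Omega>))" by simp
  then have big: "6 * \<Gamma>' \<le> int (card \<Omega>)" by (simp only: of_int_le_iff)
  have fT: "finite (U - X)" "finite X" using U X(1) finite_subset by auto
  have "\<exists>D'\<subseteq>{i, j}. balanced c ((U - X) \<union> D')"
  proof (rule balanced_by_units[OF c fT(1), where \<Gamma> = \<Gamma>' and \<Omega> = \<Omega>])
    fix D' p assume D': "D' \<subseteq> {i, j}" "p \<in> U - X \<union> D'"
    let ?W = "U \<union> {i, j}"
    have "?W - (U - X \<union> D') \<subseteq> X \<union> {i, j}" by auto
    then have "card (?W - (U - X \<union> D')) \<le> card (X \<union> {i, j})"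
      using fT by (intro card_mono) auto
    also have "\<dots> \<le> card X + card {i, j}" by (rule card_Un_le)
    also have "\<dots> \<le> card X + 2" by (simp add: card_insert_if)
    finally have "int (card (?W - (U - X \<union> D'))) \<le> int (card X) + 2" by simp
    moreover have "\<bar>\<Sum>q\<in>U - X \<union> D'. c p q\<bar> \<le> \<bar>\<Sum>q\<in>?W. c p q\<bar> + 2 * int (card (?W - (U - X \<union> D')))"
      using U D' by (intro abs_sum_diff_le[OF c]) auto
    moreover have "\<bar>\<Sum>q\<in>?W. c p q\<bar> \<le> \<Gamma>" using D' by (intro gap) auto
    moreover have "x \<le> \<Gamma> + 2 * n" if "m \<le> n" "x \<le> y + 2 * m" "y \<le> \<Gamma>" for x y m n :: int
      using that by linarith
    ultimately show "\<bar>\<Sum>q\<in>U - X \<union> D'. c p q\<bar> \<le> \<Gamma>'" unfolding \<Gamma>'_def by blast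
  qed (use ij zero \<Gamma> big B(1) in \<open>auto simp: \<Omega>_def F_def \<Gamma>'_def unit_row_def\<close>)
  then obtain D' where D': "D' \<subseteq> {i, j}" "balanced c ((U - X) \<union> D')" by blast
  have "card U = card (U - X) + card X"
    using U X(1) fT by (simp add: card_Diff_subset card_mono)
  moreover have "card (U - X) \<le> card ((U - X) \<union> D')"
    using D'(1) fT by (intro card_mono) (auto intro: finite_subset)
  ultimately have "real (card U) \<le> real (card ((U - X) \<union> D')) + real (card X)" by simp
  then have "real (card U) \<le> real (card ((U - X) \<union> D')) + real (card U) / (a * real D)"
    using X' by linarith
  then show ?thesis using D' by (intro exI[of _ "(U - X) \<union> D'"]) auto
qed

section \<open>Building pairings\<close>

lemma pairing_empty: "pairing {}"
  by (simp add: pairing_def)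

lemma pts_Un: "pts (P \<union> Q) = pts P \<union> pts Q"
  by (auto simp: pts_def)

lemma pairing_Un:
  assumes "pairing P" "pairing Q" "pts P \<inter> pts Q = {}"
  shows "pairing (P \<union> Q)"
proof -
  have "{fst p, snd p} \<inter> {fst q, snd q} = {}" if pq: "p \<in> P \<union> Q" "q \<in> P \<union> Q" "p \<noteq> q" for p q
  proof -
    have sub: "{fst r, snd r} \<subseteq> pts R" if "r \<in> R" for r :: "'a \<times> 'a" and R
      using that by (auto simp: pts_def)
    consider "p \<in> P" "q \<in> P" | "p \<in> Q" "q \<in> Q" | "p \<in> P" "q \<in> Q" | "p \<in> Q" "q \<in> P"
      using pq(1,2) by blast
    then show ?thesis
    proof cases
      case 1
      then show ?thesis using assms(1) pq(3) by (simp add: pairing_def)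
    next
      case 2
      then show ?thesis using assms(2) pq(3) by (simp add: pairing_def)
    next
      case 3
      then show ?thesis using sub[of p P] sub[of q Q] assms(3) by blast
    next
      case 4
      then show ?thesis using sub[of p Q] sub[of q P] assms(3) by blast
    qed
  qed
  moreover have "finite (P \<union> Q)" "\<forall>p\<in>P \<union> Q. fst p \<noteq> snd p"
    using assms(1,2) by (auto simp: pairing_def)
  ultimately show ?thesis by (simp only: pairing_def) blast
qed

lemma pairing_mono: "pairing P \<Longrightarrow> Q \<subseteq> P \<Longrightarrow> pairing Q"
  unfolding pairing_def by (meson finite_subset subsetD)

lemma pairing_inj:
  assumes "pairing P"
  shows "inj_on fst P" "inj_on snd P" "fst ` P \<inter> snd ` P = {}"
proof -
  show "inj_on fst P" by (intro inj_onI pairing_selection[OF assms, of fst fst]) auto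
  show "inj_on snd P" by (intro inj_onI pairing_selection[OF assms, of snd snd]) auto
  have "fst p \<noteq> snd q" if "p \<in> P" "q \<in> P" for p q
    using pairing_selection[OF assms, of fst snd p q] that assms by (auto simp: pairing_def)
  then show "fst ` P \<inter> snd ` P = {}" by blast
qed

lemma sum_pts:
  assumes "pairing P"
  shows "(\<Sum>x\<in>pts P. f x) = (\<Sum>p\<in>P. f (fst p) + f (snd p))"
  using assms pairing_inj[OF assms]
  by (simp add: pts_def sum.union_disjoint pairing_def sum.reindex sum.distrib)

lemma card_pts: "pairing P \<Longrightarrow> card (pts P) = 2 * card P"
  using sum_pts[of P "\<lambda>_. 1::nat"] by simp

lemma finite_pts: "pairing P \<Longrightarrow> finite (pts P)"
  by (simp add: pairing_def pts_def)

section \<open>Degree gaps and pairings of vertices of similar degree\<close>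

definition degree_in :: "'a graph \<Rightarrow> 'a set \<Rightarrow> 'a \<Rightarrow> int" where
  "degree_in G W v = (\<Sum>y\<in>W. adj G v y)"

lemma sum_skew:
  assumes "pairing P"
  shows "(\<Sum>q\<in>P. skew G p q) = degree_in G (pts P) (fst p) - degree_in G (pts P) (snd p)"
  by (simp add: degree_in_def sum_pts[OF assms] skew_def flip: sum_subtractf)
    (simp add: algebra_simps)

text \<open>A removed vertex lowers each degree by 0 or 1, so it changes a difference of degrees by
  at most 1.\<close>

lemma degree_in_diff:
  assumes "finite V" "W \<subseteq> V"
  shows "\<bar>degree_in G W u - degree_in G W v\<bar> \<le> \<bar>degree_in G V u - degree_in G V v\<bar> + int (card (V - W))"
proof -
  have split: "degree_in G V x = degree_in G (V - W) x + degree_in G W x" for x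
    unfolding degree_in_def by (rule sum.subset_diff[OF assms(2,1)])
  have range: "0 \<le> degree_in G (V - W) x" "degree_in G (V - W) x \<le> int (card (V - W))" for x
  proof -
    show "0 \<le> degree_in G (V - W) x"
      unfolding degree_in_def by (intro sum_nonneg) (simp add: adj_def)
    have "degree_in G (V - W) x \<le> (\<Sum>y\<in>V - W. 1)"
      unfolding degree_in_def by (intro sum_mono) (simp add: adj_def)
    then show "degree_in G (V - W) x \<le> int (card (V - W))" by simp
  qed
  show ?thesis
    using split[of u] split[of v] range[of u] range[of v] by linarith
qed

text \<open>Neighbours in increasing order are paired. The intervals between partners do not
  overlap, so the sum of the gaps, not only the largest one, is bounded by the range. The induction
  moves the lower end \<open>a\<close> up to the pair just removed.\<close>

lemma sorted_pairing:
  fixes \<delta> :: "'a \<Rightarrow> int"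
  assumes "card S = 2 * n" "finite S" "\<And>v. v \<in> S \<Longrightarrow> a \<le> \<delta> v \<and> \<delta> v \<le> b" "a \<le> b"
  shows "\<exists>P. pairing P \<and> pts P = S \<and> (\<Sum>p\<in>P. \<bar>\<delta> (fst p) - \<delta> (snd p)\<bar>) \<le> b - a"
  using assms
proof (induction n arbitrary: S a)
  case 0
  then show ?case by (intro exI[of _ "{}"]) (auto simp: pairing_empty pts_def)
next
  case (Suc n)
  have least: "\<exists>x\<in>R. \<forall>y\<in>R. \<delta> x \<le> \<delta> y" if "finite R" "R \<noteq> {}" for R
  proof -
    have "Min (\<delta> ` R) \<in> \<delta> ` R" using that by (intro Min_in) auto
    then obtain x where "x \<in> R" "\<delta> x = Min (\<delta> ` R)" by force
    then show ?thesis using that(1) by (intro bexI[of _ x]) auto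
  qed
  have "S \<noteq> {}" using Suc.prems(1) by auto
  then obtain x where x: "x \<in> S" "\<And>y. y \<in> S \<Longrightarrow> \<delta> x \<le> \<delta> y"
    using least[of S] Suc.prems(2) by metis
  have "card (S - {x}) = 2 * n + 1" using x(1) Suc.prems(1,2) by simp
  then have "S - {x} \<noteq> {}" by (intro notI) simp
  then obtain y where y: "y \<in> S - {x}" "\<And>z. z \<in> S - {x} \<Longrightarrow> \<delta> y \<le> \<delta> z"
    using least[of "S - {x}"] finite_Diff[OF Suc.prems(2)] by metis
  let ?R = "S - {x} - {y}"
  have "card ?R = 2 * n" using \<open>card (S - {x}) = 2 * n + 1\<close> y(1) Suc.prems(2) by simp
  then obtain P where P: "pairing P" "pts P = ?R" "(\<Sum>p\<in>P. \<bar>\<delta> (fst p) - \<delta> (snd p)\<bar>) \<le> b - \<delta> y"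
    using Suc.IH[of ?R "\<delta> y"] Suc.prems(2,3) y by blast
  have xy: "pairing {(x, y)}" "pts {(x, y)} = {x, y}" using y(1) by (auto simp: pairing_def pts_def)
  have finP: "finite P" using P(1) by (simp add: pairing_def)
  have "(x, y) \<notin> P" using P(2) by (force simp: pts_def)
  then have "(\<Sum>p\<in>{(x, y)} \<union> P. \<bar>\<delta> (fst p) - \<delta> (snd p)\<bar>)
      = \<bar>\<delta> x - \<delta> y\<bar> + (\<Sum>p\<in>P. \<bar>\<delta> (fst p) - \<delta> (snd p)\<bar>)"
    using finP by simp
  also have "\<dots> \<le> b - a"
  proof -
    have "\<delta> x \<le> \<delta> y" using x(2) y(1) by blast
    then show ?thesis using P(3) Suc.prems(3)[OF x(1)] by linarith
  qed
  finally have sum: "(\<Sum>p\<in>{(x, y)} \<union> P. \<bar>\<delta> (fst p) - \<delta> (snd p)\<bar>) \<le> b - a" .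
  have pair: "pairing ({(x, y)} \<union> P)" using xy P(2) by (intro pairing_Un P(1)) auto
  have pts: "pts ({(x, y)} \<union> P) = S" unfolding pts_Un xy(2) P(2) using x(1) y(1) by blast
  from sum pair pts show ?case by blast
qed

lemma sorted_pairing_range:
  fixes \<delta> :: "'a \<Rightarrow> int"
  assumes "even (card S)" "finite S" "\<And>u v. u \<in> S \<Longrightarrow> v \<in> S \<Longrightarrow> \<bar>\<delta> u - \<delta> v\<bar> \<le> \<rho>" "0 \<le> \<rho>"
  shows "\<exists>P. pairing P \<and> pts P = S \<and> (\<Sum>p\<in>P. \<bar>\<delta> (fst p) - \<delta> (snd p)\<bar>) \<le> \<rho>"
proof (cases "S = {}")
  case True
  then show ?thesis using assms(4) by (intro exI[of _ "{}"]) (auto simp: pairing_empty pts_def)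
next
  case False
  let ?a = "Min (\<delta> ` S)"
  have "?a \<in> \<delta> ` S" using False assms(2) by (intro Min_in) auto
  then obtain x where x: "x \<in> S" "\<delta> x = ?a" by force
  have "?a \<le> \<delta> v \<and> \<delta> v \<le> ?a + \<rho>" if "v \<in> S" for v
    using assms(2) that assms(3)[OF x(1) that] x(2) Min_le[of "\<delta> ` S" "\<delta> v"] by simp
  then show ?thesis
    using sorted_pairing[of S "card S div 2" ?a \<delta> "?a + \<rho>"] assms(1,2,4) by auto
qed

lemma class_pairing:
  fixes \<delta> :: "'a \<Rightarrow> int" and \<kappa> :: "'a \<Rightarrow> nat"
  assumes "finite W" "\<And>v. v \<in> W \<Longrightarrow> \<kappa> v < q" "\<And>l. even (card {v \<in> W. \<kappa> v = l})"
    "\<And>u v. u \<in> W \<Longrightarrow> v \<in> W \<Longrightarrow> \<kappa> u = \<kappa> v \<Longrightarrow> \<bar>\<delta> u - \<delta> v\<bar> \<le> \<rho>" "0 \<le> \<rho>"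
  shows "\<exists>P. pairing P \<and> pts P = W \<and> (\<forall>p\<in>P. \<kappa> (fst p) = \<kappa> (snd p)) \<and>
    (\<Sum>p\<in>P. \<bar>\<delta> (fst p) - \<delta> (snd p)\<bar>) \<le> int q * \<rho>"
  using assms(1-4)
proof (induction q arbitrary: W)
  case 0
  then show ?case by (intro exI[of _ "{}"]) (auto simp: pairing_empty pts_def)
next
  case (Suc q)
  let ?S = "{v \<in> W. \<kappa> v = q}" and ?R = "{v \<in> W. \<kappa> v < q}"
  have R: "{v \<in> ?R. \<kappa> v = l} = (if l < q then {v \<in> W. \<kappa> v = l} else {})" for l by auto
  have "even (card {v \<in> ?R. \<kappa> v = l})" for l
    using Suc.prems(3)[of l] by (simp only: R split: if_split) simp
  then have "\<exists>P. pairing P \<and> pts P = ?R \<and> (\<forall>p\<in>P. \<kappa> (fst p) = \<kappa> (snd p)) \<and>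
    (\<Sum>p\<in>P. \<bar>\<delta> (fst p) - \<delta> (snd p)\<bar>) \<le> int q * \<rho>"
    by (intro Suc.IH) (simp_all add: Suc.prems(1,4))
  then obtain P where P: "pairing P" "pts P = ?R" "\<And>p. p \<in> P \<Longrightarrow> \<kappa> (fst p) = \<kappa> (snd p)"
    "(\<Sum>p\<in>P. \<bar>\<delta> (fst p) - \<delta> (snd p)\<bar>) \<le> int q * \<rho>"
    by metis
  have "\<exists>Q. pairing Q \<and> pts Q = ?S \<and> (\<Sum>p\<in>Q. \<bar>\<delta> (fst p) - \<delta> (snd p)\<bar>) \<le> \<rho>"
    by (intro sorted_pairing_range) (simp_all add: Suc.prems(1,3,4) assms(5))
  then obtain Q where Q: "pairing Q" "pts Q = ?S" "(\<Sum>p\<in>Q. \<bar>\<delta> (fst p) - \<delta> (snd p)\<bar>) \<le> \<rho>"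
    by metis
  have \<kappa>Q: "\<kappa> (fst p) = \<kappa> (snd p)" if "p \<in> Q" for p
  proof -
    have "fst p \<in> pts Q" "snd p \<in> pts Q" using that by (auto simp: pts_def)
    then show ?thesis using Q(2) by simp
  qed
  have disj: "pts P \<inter> pts Q = {}" using P(2) Q(2) by auto
  then have PQ: "P \<inter> Q = {}" by (force simp: pts_def)
  have fin: "finite P" "finite Q" using P(1) Q(1) by (simp_all add: pairing_def)
  have sum: "(\<Sum>p\<in>P \<union> Q. \<bar>\<delta> (fst p) - \<delta> (snd p)\<bar>) \<le> int (Suc q) * \<rho>"
    using P(4) Q(3) unfolding sum.union_disjoint[OF fin PQ] by (simp add: algebra_simps)
  have pts: "pts (P \<union> Q) = W"
    unfolding pts_Un P(2) Q(2) using Suc.prems(2) less_Suc_eq by blast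
  have "\<forall>p\<in>P \<union> Q. \<kappa> (fst p) = \<kappa> (snd p)" using P(3) \<kappa>Q by blast
  with pairing_Un[OF P(1) Q(1) disj] pts sum show ?case by blast
qed

lemma even_classes:
  fixes \<kappa> :: "'a \<Rightarrow> nat"
  assumes "finite V" "\<And>v. v \<in> V \<Longrightarrow> \<kappa> v < q"
  shows "\<exists>W\<subseteq>V. card (V - W) \<le> q \<and> (\<forall>l. even (card {v \<in> W. \<kappa> v = l}))"
proof -
  define r where "r l = (SOME v. v \<in> V \<and> \<kappa> v = l)" for l
  define L where "L = {l. odd (card {v \<in> V. \<kappa> v = l})}"
  have r: "r l \<in> V \<and> \<kappa> (r l) = l" if "l \<in> L" for l
  proof -
    have "{v \<in> V. \<kappa> v = l} \<noteq> {}"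
    proof
      assume "{v \<in> V. \<kappa> v = l} = {}"
      then have "even (card {v \<in> V. \<kappa> v = l})" by (simp only: card.empty even_zero)
      then show False using that by (simp add: L_def)
    qed
    then have "\<exists>v. v \<in> V \<and> \<kappa> v = l" by blast
    then show ?thesis unfolding r_def by (rule someI_ex)
  qed
  have L: "L \<subseteq> {..<q}" using r assms(2) by (metis lessThan_iff subsetI)
  have "card (r ` L) \<le> card {..<q}"
    using L card_image_le[of L r] card_mono[of "{..<q}" L] finite_subset[of L "{..<q}"] by simp
  moreover have "V - (V - r ` L) = r ` L" using r by auto
  moreover have "even (card {v \<in> V - r ` L. \<kappa> v = l})" for l
  proof (cases "l \<in> L")
    case True
    then have "{v \<in> V - r ` L. \<kappa> v = l} = {v \<in> V. \<kappa> v = l} - {r l}" using r by auto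
    moreover have "card ({v \<in> V. \<kappa> v = l} - {r l}) = card {v \<in> V. \<kappa> v = l} - 1"
      using r[OF True] by (intro card_Diff_singleton) simp
    ultimately show ?thesis using True by (simp add: L_def)
  next
    case False
    then have "{v \<in> V - r ` L. \<kappa> v = l} = {v \<in> V. \<kappa> v = l}" using r by auto
    then show ?thesis using False by (simp add: L_def)
  qed
  ultimately show ?thesis by (intro exI[of _ "V - r ` L"]) auto
qed

lemma nat_div_eq_imp_diff_less:
  fixes x y w :: nat
  assumes "x div w = y div w" "0 < w"
  shows "\<bar>int x - int y\<bar> < int w"
proof -
  have "int x - int y = int (x mod w) - int (y mod w)"
    using assms(1) div_mult_mod_eq[of x w] div_mult_mod_eq[of y w]
    by (metis add_diff_cancel_left of_nat_add)
  moreover have "x mod w < w" "y mod w < w" using assms(2) by auto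
  ultimately show ?thesis by linarith
qed

lemma degree_in_bounds:
  shows "0 \<le> degree_in G W v" and "degree_in G W v \<le> int (card W)"
proof -
  show "0 \<le> degree_in G W v" unfolding degree_in_def by (intro sum_nonneg) (simp add: adj_def)
  have "degree_in G W v \<le> (\<Sum>y\<in>W. 1)" unfolding degree_in_def by (intro sum_mono) (simp add: adj_def)
  then show "degree_in G W v \<le> int (card W)" by simp
qed

text \<open>The adjacencies to the four vertices of the switch, as bits of a number that later
  serves as one digit of a class number. Partners with equal codes have skew 0 towards
  \<open>i\<close> and \<open>j\<close>.\<close>

definition adj_code :: "'a graph \<Rightarrow> 'a \<times> 'a \<Rightarrow> 'a \<times> 'a \<Rightarrow> 'a \<Rightarrow> nat" where
  "adj_code G i j v = of_bool ({v, fst i} \<in> edges G) + 2 * of_bool ({v, snd i} \<in> edges G)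
     + 4 * of_bool ({v, fst j} \<in> edges G) + 8 * of_bool ({v, snd j} \<in> edges G)"

lemma adj_code_less: "adj_code G i j v < 16"
proof -
  have "of_bool b \<le> (1::nat)" for b by simp
  then have "adj_code G i j v \<le> 1 + 2 * 1 + 4 * 1 + 8 * 1"
    unfolding adj_code_def by (intro add_mono mult_left_mono) auto
  then show ?thesis by simp
qed

lemma adj_code_eq_imp_skew_eq_0:
  assumes "adj_code G i j u = adj_code G i j v"
  shows "skew G (u, v) i = 0" "skew G (u, v) j = 0"
proof -
  have bit: "P1 = Q1 \<and> P2 = Q2 \<and> P3 = Q3 \<and> P4 = Q4"
    if "of_bool P1 + 2 * of_bool P2 + 4 * of_bool P3 + 8 * of_bool P4
      = (of_bool Q1 + 2 * of_bool Q2 + 4 * of_bool Q3 + 8 * of_bool Q4 :: nat)" for P1 P2 P3 P4 Q1 Q2 Q3 Q4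
    using that by (cases P1; cases P2; cases P3; cases P4; cases Q1; cases Q2; cases Q3; cases Q4) simp_all
  from bit[OF assms[unfolded adj_code_def]]
  show "skew G (u, v) i = 0" "skew G (u, v) j = 0" by (simp_all add: skew_def adj_def)
qed

text \<open>Adding 1 to the width of a class makes \<open>d\<close> classes suffice for degrees up
  to the number of vertices; differences inside a class stay below the width, hence at most the
  quotient.\<close>

definition degree_class :: "'a graph \<Rightarrow> nat \<Rightarrow> 'a \<Rightarrow> nat" where
  "degree_class G d v = nat (degree_in G (verts G) v) div (card (verts G) div d + 1)"

lemma degree_class_less:
  assumes "0 < d"
  shows "degree_class G d v < d"
proof -
  have "nat (degree_in G (verts G) v) \<le> card (verts G)" using degree_in_bounds[of G "verts G" v] by simp
  also have "\<dots> < (card (verts G) div d + 1) * d"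
    using dividend_less_div_times[OF assms, of "card (verts G)"] by (simp add: algebra_simps)
  finally show ?thesis
    unfolding degree_class_def by (simp add: less_mult_imp_div_less mult.commute)
qed

lemma degree_class_eq_imp_diff_le:
  assumes "degree_class G d u = degree_class G d v"
  shows "\<bar>degree_in G (verts G) u - degree_in G (verts G) v\<bar> \<le> int (card (verts G) div d)"
  using nat_div_eq_imp_diff_less[OF assms[unfolded degree_class_def]] degree_in_bounds(1)[of G "verts G" u]
    degree_in_bounds(1)[of G "verts G" v]
  by simp

text \<open>Vertices are paired inside degree classes, at most one being lost per class. If all
  entries of the matrix vanish, all gaps are zero; otherwise a nonzero entry supplies the switch,
  and the common classes keep the gaps of its two pairs small later.\<close>

lemma trivial_or_switch:
  assumes G: "simple_graph G" and d: "0 < d"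
  shows "card (verts G) \<le> 2 * max_equal_pair G + d \<or>
    (\<exists>i j. pairing {i, j} \<and> pts {i, j} \<subseteq> verts G \<and> skew G i j \<noteq> 0 \<and>
       (\<forall>p\<in>{i, j}. degree_class G d (fst p) = degree_class G d (snd p)))"
proof -
  have fV: "finite (verts G)" using G by (simp add: simple_graph_def)
  have "\<exists>W\<subseteq>verts G. card (verts G - W) \<le> d \<and> (\<forall>l. even (card {v \<in> W. degree_class G d v = l}))"
    by (rule even_classes[OF fV degree_class_less[OF d]])
  then obtain W where W: "W \<subseteq> verts G" "card (verts G - W) \<le> d"
    "\<And>l. even (card {v \<in> W. degree_class G d v = l})"
    by (elim exE conjE) simp
  have fW: "finite W" using W(1) fV finite_subset by blast
  have "\<exists>P. pairing P \<and> pts P = W \<and> (\<forall>p\<in>P. degree_class G d (fst p) = degree_class G d (snd p)) \<and>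
    (\<Sum>p\<in>P. \<bar>0 - 0 :: int\<bar>) \<le> int d * 0"
    by (rule class_pairing[where \<delta> = "\<lambda>_. 0"]) (use fW W(3) degree_class_less[OF d] in simp_all)
  then obtain P where P: "pairing P" "pts P = W" "\<And>p. p \<in> P \<Longrightarrow> degree_class G d (fst p) = degree_class G d (snd p)"
    by metis
  show ?thesis
  proof (cases "\<forall>p\<in>P. \<forall>q\<in>P. skew G p q = 0")
    case True
    then have "balanced (skew G) P" by (intro balanced_if_zero) auto
    then have "card P \<le> max_equal_pair G"
      using balanced_imp_max_equal_pair_ge[OF G P(1)] P(2) W(1) by simp
    moreover have "card (verts G) = card W + card (verts G - W)"
      using W(1) fV fW by (simp add: card_Diff_subset card_mono)
    moreover have "card W = 2 * card P" using card_pts[OF P(1)] P(2) by simp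
    ultimately show ?thesis using W(2) by linarith
  next
    case False
    then obtain i j where ij: "i \<in> P" "j \<in> P" "skew G i j \<noteq> 0" by blast
    then have sub: "{i, j} \<subseteq> P" by simp
    then have "pts {i, j} \<subseteq> verts G" using P(2) W(1) by (auto simp: pts_def)
    then show ?thesis using pairing_mono[OF P(1) sub] ij P(3) by blast
  qed
qed

text \<open>The pairing in which the switch was found is discarded, as its other pairs may notice
  the switch. The remaining vertices are classified anew by degree and adjacency to the switch. In
  \<open>\<Gamma>\<close> the quotient comes from the width of a degree class, and 16d bounds the
  vertices lost to parity. The bound on the sum of the gaps is kept as well: it later shows that
  most gaps are bounded by a constant.\<close>

lemma pairing_around_switch:
  assumes G: "simple_graph G" and d: "0 < d"
    and ij: "pairing {i, j}" "pts {i, j} \<subseteq> verts G" "i \<noteq> j"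
      "\<And>p. p \<in> {i, j} \<Longrightarrow> degree_class G d (fst p) = degree_class G d (snd p)"
  defines "\<Gamma> \<equiv> int (card (verts G) div d) + 16 * int d"
  shows "\<exists>U. pairing (U \<union> {i, j}) \<and> pts (U \<union> {i, j}) \<subseteq> verts G \<and> i \<notin> U \<and> j \<notin> U \<and>
    card (verts G) \<le> 2 * card U + 4 + 16 * d \<and>
    (\<forall>k\<in>U. skew G k i = 0 \<and> skew G k j = 0) \<and>
    (\<forall>p\<in>U \<union> {i, j}. \<bar>\<Sum>q\<in>U \<union> {i, j}. skew G p q\<bar> \<le> \<Gamma>) \<and>
    (\<Sum>p\<in>U. \<bar>\<Sum>q\<in>U \<union> {i, j}. skew G p q\<bar>) \<le> 16 * int d * \<Gamma>"
proof -
  let ?V = "verts G" and ?Z = "pts {i, j}"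
  have fV: "finite ?V" using G by (simp add: simple_graph_def)
  have fZ: "finite ?Z" using finite_pts[OF ij(1)] .
  have cZ: "card ?Z = 4" using card_pts[OF ij(1)] ij(3) by simp
  \<comment> \<open>The remainder modulo \<open>d\<close> is the degree class and the quotient is
    the adjacency code.\<close>
  define \<kappa> where "\<kappa> v = degree_class G d v + d * adj_code G i j v" for v
  have \<kappa>_less: "\<kappa> v < 16 * d" for v
  proof -
    have "d * adj_code G i j v \<le> d * 15" using adj_code_less[of G i j v] by (intro mult_left_mono) auto
    then show ?thesis using degree_class_less[OF d, of G v] unfolding \<kappa>_def by linarith
  qed
  have \<kappa>_eq: "degree_class G d u = degree_class G d v \<and> adj_code G i j u = adj_code G i j v"
    if "\<kappa> u = \<kappa> v" for u v
  proof -
    have "\<kappa> x mod d = degree_class G d x" "\<kappa> x div d = adj_code G i j x" for x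
      using degree_class_less[OF d, of G x] d by (simp_all add: \<kappa>_def)
    then show ?thesis using that by metis
  qed
  have "\<exists>W\<subseteq>?V - ?Z. card (?V - ?Z - W) \<le> 16 * d \<and> (\<forall>l. even (card {v \<in> W. \<kappa> v = l}))"
    by (rule even_classes[OF finite_Diff[OF fV] \<kappa>_less])
  then obtain W where W: "W \<subseteq> ?V - ?Z" "card (?V - ?Z - W) \<le> 16 * d" "\<And>l. even (card {v \<in> W. \<kappa> v = l})"
    by (elim exE conjE) simp
  have fW: "finite W" using W(1) fV by (auto intro: finite_subset)
  \<comment> \<open>Classes use degrees in \<open>G\<close>, but the sorting uses degrees among the
    vertices kept, since those give the row sums. They are known because \<open>W\<close> is fixed
    before it is paired.\<close>
  define \<delta> where "\<delta> = degree_in G (W \<union> ?Z)"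
  have sub: "W \<union> ?Z \<subseteq> ?V" using W(1) ij(2) by blast
  have rest: "?V - (W \<union> ?Z) = ?V - ?Z - W" by blast
  have \<delta>_le: "\<bar>\<delta> u - \<delta> v\<bar> \<le> \<Gamma>" if "degree_class G d u = degree_class G d v" for u v
  proof -
    have "int (card (?V - (W \<union> ?Z))) \<le> 16 * int d" using W(2) unfolding rest by linarith
    then show ?thesis
      using degree_in_diff[OF fV sub, of G u v] degree_class_eq_imp_diff_le[OF that]
      unfolding \<delta>_def \<Gamma>_def by linarith
  qed
  have "0 \<le> \<Gamma>" by (simp add: \<Gamma>_def)
  have "\<exists>P. pairing P \<and> pts P = W \<and> (\<forall>p\<in>P. \<kappa> (fst p) = \<kappa> (snd p)) \<and>
    (\<Sum>p\<in>P. \<bar>\<delta> (fst p) - \<delta> (snd p)\<bar>) \<le> int (16 * d) * \<Gamma>"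
    by (rule class_pairing[OF fW \<kappa>_less W(3) _ \<open>0 \<le> \<Gamma>\<close>]) (use \<delta>_le \<kappa>_eq in blast)
  then obtain U where U: "pairing U" "pts U = W" "\<And>p. p \<in> U \<Longrightarrow> \<kappa> (fst p) = \<kappa> (snd p)"
    "(\<Sum>p\<in>U. \<bar>\<delta> (fst p) - \<delta> (snd p)\<bar>) \<le> int (16 * d) * \<Gamma>" by metis
  have disj: "pts U \<inter> ?Z = {}" using U(2) W(1) by blast
  have pair: "pairing (U \<union> {i, j})" by (rule pairing_Un[OF U(1) ij(1) disj])
  have pts: "pts (U \<union> {i, j}) = W \<union> ?Z" unfolding pts_Un U(2) ..
  have row: "(\<Sum>q\<in>U \<union> {i, j}. skew G p q) = \<delta> (fst p) - \<delta> (snd p)" for p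
    unfolding sum_skew[OF pair] pts \<delta>_def ..
  have notin: "i \<notin> U" "j \<notin> U" using disj by (auto simp: pts_def)
  have "card ?V = card (W \<union> ?Z) + card (?V - ?Z - W)"
    using card_Diff_subset[OF finite_subset[OF sub fV] sub] card_mono[OF fV sub] unfolding rest by simp
  moreover have "card (W \<union> ?Z) \<le> card W + 4" using card_Un_le[of W ?Z] cZ by simp
  moreover have "card W = 2 * card U" using card_pts[OF U(1)] U(2) by simp
  ultimately have card: "card ?V \<le> 2 * card U + 4 + 16 * d" using W(2) by linarith
  have zero: "skew G k i = 0 \<and> skew G k j = 0" if "k \<in> U" for k
    using adj_code_eq_imp_skew_eq_0[OF conjunct2[OF \<kappa>_eq[OF U(3)[OF that]]]]
    unfolding prod.collapse by blast
  have small: "\<bar>\<Sum>q\<in>U \<union> {i, j}. skew G p q\<bar> \<le> \<Gamma>" if "p \<in> U \<union> {i, j}" for p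
  proof -
    have "degree_class G d (fst p) = degree_class G d (snd p)"
    proof (cases "p \<in> U")
      case True
      then show ?thesis using \<kappa>_eq[OF U(3)] by blast
    next
      case False
      then show ?thesis using ij(4) that by blast
    qed
    then show ?thesis unfolding row by (rule \<delta>_le)
  qed
  have total: "(\<Sum>p\<in>U. \<bar>\<Sum>q\<in>U \<union> {i, j}. skew G p q\<bar>) \<le> 16 * int d * \<Gamma>"
    using U(4) unfolding row by simp
  show ?thesis
    using pair sub[folded pts] notin card zero small total by (intro exI[of _ U] conjI ballI) blast+
qed

section \<open>The lower bound\<close>

text \<open>Losses are measured in x = n/d, which is at least \<open>d ^ 4\<close>. If at most
  \<epsilon>n/4 pairs have rows longer than \<open>d\<close>, they are dropped. Otherwise at most
  \<epsilon>n/8 of them have a gap above \<open>K\<close>, because the gaps sum to at most 16d times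
  17x, that is 272n, and 2176 is 8 times 272; the others, at least \<epsilon>n/8, feed
  \<open>balanced_large_rows\<close>.\<close>

lemma max_equal_pair_lower_aux:
  fixes \<epsilon> :: real and K d n :: nat
  assumes G: "simple_graph G" "card (verts G) = n"
    and d: "d ^ 5 \<le> n" "16 * K \<le> d" "116 \<le> \<epsilon> * d"
    and K: "1 \<le> K" "2176 \<le> \<epsilon> * K" and \<epsilon>: "0 < \<epsilon>"
  defines "a \<equiv> (1 / (32 * real K)) ^ K / 2"
  assumes large: "96 * (21 + 2 / a) * real (floor_log n + 1) \<le> a * \<epsilon> * d"
  shows "real n / 2 - \<epsilon> * n \<le> max_equal_pair G"
proof -
  define x where "x = real n / real d"
  have d1: "1 \<le> d" using d(2) K(1) by linarith
  have n: "real n = x * d" using d1 by (simp add: x_def)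
  have "d * d ^ 4 \<le> n" using d(1) by (simp add: eval_nat_numeral)
  then have "real d * real d ^ 4 \<le> real n" by (metis of_nat_le_iff of_nat_mult of_nat_power)
  then have d4: "real d ^ 4 \<le> x" using d1 by (simp add: x_def field_simps)
  have pow: "real d ^ l \<le> real d ^ 4" if "l \<le> 4" for l
    using d1 that by (intro power_increasing) auto
  have dx: "1 \<le> x" "real d \<le> x" using pow[of 0] pow[of 1] d4 unfolding power_0 power_one_right by linarith+
  have x\<epsilon>: "116 * x \<le> \<epsilon> * n"
    using mult_right_mono[OF d(3), of x] dx(1) by (simp add: n mult_ac)
  have a: "0 < a" "a \<le> 1"
  proof -
    show "0 < a" using K(1) by (simp add: a_def)
    have "(1 / (32 * real K)) ^ K \<le> 1" using K(1) by (intro power_le_one) auto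
    then show "a \<le> 1" by (simp add: a_def)
  qed
  have cm: "cross_matrix (skew G)" by (rule cross_matrix_skew[OF G(1)])
  have fV: "finite (verts G)" using G by (simp add: simple_graph_def)
  from trivial_or_switch[OF G(1), of d] d1
  consider "n \<le> 2 * max_equal_pair G + d" | i j where "pairing {i, j}" "pts {i, j} \<subseteq> verts G"
    "skew G i j \<noteq> 0" "\<And>p. p \<in> {i, j} \<Longrightarrow> degree_class G d (fst p) = degree_class G d (snd p)"
    unfolding G(2) by force
  then show ?thesis
  proof cases
    case 1
    then have "real n \<le> 2 * real (max_equal_pair G) + x" using dx(2) by linarith
    then show ?thesis using x\<epsilon> dx(1) by linarith
  next
    case (2 i j)
    then have ij: "i \<noteq> j" using skew_self[OF G(1), of i] by metis
    define \<Gamma> where "\<Gamma> = int (n div d) + 16 * int d"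
    have "0 < d" using d1 by simp
    have "\<exists>U. pairing (U \<union> {i, j}) \<and> pts (U \<union> {i, j}) \<subseteq> verts G \<and> i \<notin> U \<and> j \<notin> U \<and>
      n \<le> 2 * card U + 4 + 16 * d \<and> (\<forall>k\<in>U. skew G k i = 0 \<and> skew G k j = 0) \<and>
      (\<forall>p\<in>U \<union> {i, j}. \<bar>\<Sum>q\<in>U \<union> {i, j}. skew G p q\<bar> \<le> \<Gamma>) \<and>
      (\<Sum>p\<in>U. \<bar>\<Sum>q\<in>U \<union> {i, j}. skew G p q\<bar>) \<le> 16 * int d * \<Gamma>"
      using pairing_around_switch[OF G(1) \<open>0 < d\<close> 2(1,2) ij 2(4)] unfolding G(2) \<Gamma>_def .
    then obtain U where *: "pairing (U \<union> {i, j}) \<and> pts (U \<union> {i, j}) \<subseteq> verts G \<and> i \<notin> U \<and> j \<notin> U \<and>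
      n \<le> 2 * card U + 4 + 16 * d \<and> (\<forall>k\<in>U. skew G k i = 0 \<and> skew G k j = 0) \<and>
      (\<forall>p\<in>U \<union> {i, j}. \<bar>\<Sum>q\<in>U \<union> {i, j}. skew G p q\<bar> \<le> \<Gamma>) \<and>
      (\<Sum>p\<in>U. \<bar>\<Sum>q\<in>U \<union> {i, j}. skew G p q\<bar>) \<le> 16 * int d * \<Gamma>" by (rule exE)
    have U: "pairing (U \<union> {i, j})" "pts (U \<union> {i, j}) \<subseteq> verts G" "i \<notin> U" "j \<notin> U"
      "n \<le> 2 * card U + 4 + 16 * d" and zero: "\<And>k. k \<in> U \<Longrightarrow> skew G k i = 0 \<and> skew G k j = 0"
      and gap: "\<And>p. p \<in> U \<union> {i, j} \<Longrightarrow> \<bar>\<Sum>q\<in>U \<union> {i, j}. skew G p q\<bar> \<le> \<Gamma>"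
      and total: "(\<Sum>p\<in>U. \<bar>\<Sum>q\<in>U \<union> {i, j}. skew G p q\<bar>) \<le> 16 * int d * \<Gamma>"
      using * by (elim conjE; blast)+
    have fU: "finite U" using U(1) by (simp add: pairing_def)
    have final: "card T \<le> max_equal_pair G" if "T \<subseteq> U \<union> {i, j}" "balanced (skew G) T" for T
    proof -
      have "pts T \<subseteq> verts G" using that(1) U(2) by (auto simp: pts_def)
      then show ?thesis using balanced_imp_max_equal_pair_ge[OF G(1) pairing_mono[OF U(1) that(1)]] that(2) by blast
    qed
    have m: "card U \<le> n"
    proof -
      have "card U \<le> card (U \<union> {i, j})" using fU by (intro card_mono) auto
      also have "2 * card (U \<union> {i, j}) \<le> n"
        using card_mono[OF fV U(2)] card_pts[OF U(1)] G(2) by simp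
      then have "card (U \<union> {i, j}) \<le> n" by linarith
      finally show ?thesis .
    qed
    have "real n \<le> 2 * real (card U) + 4 + 16 * real d" using U(5) by linarith
    then have mU: "real n / 2 - 10 * x \<le> real (card U)" using dx by linarith
    have same: "(\<Sum>q\<in>U \<union> {i, j}. skew G k q) = (\<Sum>q\<in>U. skew G k q)" if "k \<in> U" for k
      using fU zero[OF that] by (intro sum.mono_neutral_right) auto
    have "real (n div d) \<le> x" unfolding x_def by (rule of_nat_div_le_of_nat)
    then have \<Gamma>: "0 \<le> \<Gamma>" "of_int \<Gamma> \<le> 17 * x" using dx by (simp_all add: \<Gamma>_def)
    define L where "L = {k \<in> U. d < card {q \<in> U. skew G k q \<noteq> 0}}"
    have fL: "finite L" using fU by (simp add: L_def)
    show ?thesis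
    proof (cases "real (card L) \<le> \<epsilon> * n / 4")
      case True
      let ?P = "U - L"
      have rowsP: "card {q \<in> ?P. skew G p q \<noteq> 0} \<le> d" if "p \<in> ?P" for p
      proof -
        have "card {q \<in> ?P. skew G p q \<noteq> 0} \<le> card {q \<in> U. skew G p q \<noteq> 0}"
          using fU by (intro card_mono) auto
        also have "\<dots> \<le> d" using that by (auto simp: L_def)
        finally show ?thesis .
      qed
      \<comment> \<open>With the square of \<open>d\<close> as column bound, the heavy columns cost
        at most n/d pairs, and the gadgets only O(d^4).\<close>
      have "\<exists>T\<subseteq>?P. balanced (skew G) T \<and> d\<^sup>2 * card ?P \<le> d\<^sup>2 * card T + d * card ?P
          + d\<^sup>2 * (12 * d * d + (2 * (12 * d) + 2) * (d\<^sup>2 + 1) + 12 * d * d * d\<^sup>2)"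
        by (rule balanced_small_rows[OF cm finite_Diff[OF fU] rowsP])
      then obtain T where T: "T \<subseteq> ?P" "balanced (skew G) T"
        "d\<^sup>2 * card ?P \<le> d\<^sup>2 * card T + d * card ?P
          + d\<^sup>2 * (12 * d * d + (2 * (12 * d) + 2) * (d\<^sup>2 + 1) + 12 * d * d * d\<^sup>2)" (is "_ \<le> _ + _ + _ * ?z")
        by (elim exE conjE)
      have "real ?z = 12 * real d ^ 2 + (24 * real d + 2) * (real d ^ 2 + 1) + 12 * real d ^ 4"
        by (simp add: algebra_simps eval_nat_numeral)
      also have "\<dots> = 12 * real d ^ 4 + 24 * real d ^ 3 + 14 * real d ^ 2 + 24 * real d ^ 1 + 2 * real d ^ 0"
        by (simp add: algebra_simps eval_nat_numeral)
      also have "\<dots> \<le> 76 * real d ^ 4"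
        using pow[of 3] pow[of 2] pow[of 1] pow[of 0] by linarith
      finally have z: "real ?z \<le> 76 * x" using d4 by linarith
      have "real (d\<^sup>2 * card ?P) \<le> real (d\<^sup>2 * card T + d * card ?P + d\<^sup>2 * ?z)"
        using T(3) by (simp only: of_nat_le_iff)
      then have "real d * (real d * card ?P) \<le> real d * (real d * card T + card ?P + real d * ?z)"
        by (simp only: of_nat_add of_nat_mult power2_eq_square distrib_left mult.assoc)
      then have "real d * card ?P \<le> real d * card T + card ?P + real d * ?z"
        using d1 by (simp only: mult_le_cancel_left_pos of_nat_0_less_iff)
      moreover have "real (card ?P) \<le> real d * x"
      proof -
        have "card ?P \<le> n" using m card_mono[OF fU, of ?P] by simp
        then show ?thesis using n by (simp add: mult.commute)
      qed
      ultimately have "real d * card ?P \<le> real d * (card T + x + ?z)"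
        by (simp only: distrib_left)
      then have "real (card ?P) \<le> card T + x + ?z"
        using d1 by (simp only: mult_le_cancel_left_pos of_nat_0_less_iff)
      moreover have "real (card ?P) = real (card U) - real (card L)"
        using fU fL by (simp add: card_Diff_subset L_def of_nat_diff card_mono)
      moreover have "card T \<le> max_equal_pair G" using T by (intro final) auto
      \<comment> \<open>87 = 10 + 1 + 76 collects the losses from building \<open>U\<close>, from
        heavy columns and from gadgets. It is 3/4 of 116, so they amount to at most 3/4 of
        \<epsilon>n.\<close>
      ultimately have "real n / 2 - 87 * x - \<epsilon> * n / 4 \<le> max_equal_pair G"
        using z mU True by linarith
      then show ?thesis using x\<epsilon> by linarith
    next
      case False
      define B where "B = {k \<in> L. \<bar>\<Sum>q\<in>U. skew G k q\<bar> \<le> int K}"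
      have BL: "B \<subseteq> L" "L \<subseteq> U" by (auto simp: B_def L_def)
      have "int K * int (card (L - B)) = (\<Sum>k\<in>L - B. int K)" by simp
      also have "\<dots> \<le> (\<Sum>k\<in>L - B. \<bar>\<Sum>q\<in>U \<union> {i, j}. skew G k q\<bar>)"
        using same BL by (intro sum_mono) (auto simp: B_def not_le subset_iff)
      also have "\<dots> \<le> (\<Sum>k\<in>U. \<bar>\<Sum>q\<in>U \<union> {i, j}. skew G k q\<bar>)"
        using fU BL by (intro sum_mono2) auto
      also note total
      finally have "real_of_int (int K * int (card (L - B))) \<le> real_of_int (16 * int d * \<Gamma>)"
        by (simp only: of_int_le_iff)
      then have "real K * card (L - B) \<le> 16 * real d * of_int \<Gamma>" by simp
      also have "\<dots> \<le> 16 * real d * (17 * x)" using \<Gamma> by (intro mult_left_mono) auto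
      also have "\<dots> = 272 * n" by (simp add: n)
      finally have "\<epsilon> * (real K * card (L - B)) \<le> \<epsilon> * (272 * n)" using \<epsilon> by (intro mult_left_mono) auto
      moreover have "2176 * real (card (L - B)) \<le> \<epsilon> * K * card (L - B)"
        using K(2) by (intro mult_right_mono) auto
      ultimately have "real (card (L - B)) \<le> \<epsilon> * n / 8" by (simp add: mult_ac)
      moreover have "real (card L) = card B + card (L - B)"
        using fL BL card_mono[OF fL BL(1)] by (simp add: card_Diff_subset finite_subset)
      ultimately have cB: "\<epsilon> * n / 8 \<le> card B" using False by linarith
      let ?l = "real (floor_log (card U) + 1)" and ?L = "real (floor_log n + 1)"
      have l: "0 < ?l" "?l \<le> ?L" using floor_log_le_iff[OF m] by auto
      have mx: "real (card U) / (a * d) \<le> x / a"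
      proof -
        have "real (card U) / (a * d) \<le> real n / (a * d)"
          using m a by (intro divide_right_mono) auto
        then show ?thesis by (simp add: x_def mult.commute)
      qed
      \<comment> \<open>The factor 6(17 + 4 + 2/a) meets 16, which is 8 from the \<epsilon>n/8 rows
        times 2 from the halving in \<open>balanced_large_rows\<close>; this is the origin of 96(21
        + 2/a) in \<open>large\<close>.\<close>
      have "6 * (of_int \<Gamma> + 2 * (real (card U) / (a * d)) + 4) \<le> 6 * (17 * x + 2 * (x / a) + 4 * x)"
        using \<Gamma> mx dx by (intro mult_left_mono add_mono) auto
      also have "\<dots> = (96 * (21 + 2 / a) * ?L) * x / (16 * ?L)" by (simp add: field_simps)
      also have "\<dots> \<le> (a * \<epsilon> * d) * x / (16 * ?L)"
        using large dx by (intro divide_right_mono mult_right_mono) auto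
      also have "\<dots> = a * (\<epsilon> * n / 8) / (2 * ?L)" by (simp add: n field_simps)
      also have "\<dots> \<le> a * card B / (2 * ?L)" using cB a by (intro divide_right_mono mult_left_mono) auto
      also have "\<dots> \<le> a * card B / (2 * ?l)" using l a by (intro divide_left_mono) auto
      finally have many: "6 * (of_int \<Gamma> + 2 * (real (card U) / (a * d)) + 4) \<le> a * card B / (2 * ?l)" .
      have rows: "d < card {q \<in> U. skew G k q \<noteq> 0}" "\<bar>\<Sum>q\<in>U. skew G k q\<bar> \<le> int K" if "k \<in> B" for k
        using that by (auto simp: B_def L_def)
      obtain T where T: "T \<subseteq> U \<union> {i, j}" "balanced (skew G) T"
        "real (card U) \<le> card T + real (card U) / (a * d)"
        using balanced_large_rows[OF cm fU U(3,4) 2(3) zero gap \<Gamma>(1) K(1) d(2) subset_trans[OF BL] rows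
          many[unfolded a_def]] unfolding a_def by auto
      have "real n / 2 - 10 * x - x / a \<le> max_equal_pair G"
        using T(3) mU mx final[OF T(1,2)] by linarith
      moreover have "10 * x + x / a \<le> \<epsilon> * n"
      proof -
        have "10 + 1 / a \<le> 96 * (21 + 2 / a) * 1" using a by (simp add: field_simps)
        also have "\<dots> \<le> 96 * (21 + 2 / a) * ?L" using a by (intro mult_left_mono) auto
        also note large
        also have "a * \<epsilon> * d \<le> 1 * \<epsilon> * d" using a \<epsilon> by (intro mult_right_mono) auto
        finally have "(10 + 1 / a) * x \<le> 1 * \<epsilon> * d * x" using dx by (intro mult_right_mono) auto
        then show ?thesis by (simp add: n distrib_right distrib_left mult_ac)
      qed
      ultimately show ?thesis by linarith
    qed
  qed
qed

text \<open>\<open>K\<close>, and with it \<open>a\<close>, depends on \<epsilon> alone. So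
  \<open>d\<close>, of order n^(1/5), eventually exceeds the multiple of the logarithm in
  \<open>large\<close>, however small \<open>a\<close> is.\<close>

lemma max_equal_pair_lower:
  fixes \<epsilon> :: real
  assumes \<epsilon>: "0 < \<epsilon>"
  shows "\<exists>N. \<forall>G :: 'a graph. simple_graph G \<longrightarrow> N < card (verts G) \<longrightarrow>
    real (card (verts G)) / 2 - \<epsilon> * card (verts G) \<le> max_equal_pair G"
proof -
  define K where "K = nat \<lceil>2176 / \<epsilon>\<rceil>"
  define a where "a = (1 / (32 * real K)) ^ K / 2"
  have "2176 / \<epsilon> \<le> K" using \<epsilon> by (simp add: K_def)
  then have K: "2176 \<le> \<epsilon> * K" using \<epsilon> by (simp add: field_simps)
  have K1: "1 \<le> K"
    using K by (cases K) simp_all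
  have a: "0 < a" using K1 by (simp add: a_def)
  define d where "d n = nat \<lfloor>real n powr (1 / 5)\<rfloor>" for n
  have "filterlim (\<lambda>n::nat. real n powr (1 / 5) - 1) at_top sequentially" by real_asymp
  then have ev1: "\<forall>\<^sub>F n in sequentially. max (16 * K) (116 / \<epsilon>) \<le> real n powr (1 / 5) - 1"
    unfolding filterlim_at_top by blast
  have "(\<lambda>n::nat. (log 2 n + 1) / (real n powr (1 / 5) - 1)) \<longlonglongrightarrow> 0" by real_asymp
  moreover have "0 < a * \<epsilon> / (96 * (21 + 2 / a))" using a \<epsilon> by (simp add: add_pos_pos)
  ultimately have ev2: "\<forall>\<^sub>F n in sequentially.
      (log 2 (real n) + 1) / (real n powr (1 / 5) - 1) < a * \<epsilon> / (96 * (21 + 2 / a))"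
    by (rule order_tendstoD(2))
  have "\<forall>\<^sub>F n in sequentially. 16 * K \<le> d n \<and> d n ^ 5 \<le> n \<and> 116 \<le> \<epsilon> * d n \<and>
      96 * (21 + 2 / a) * real (floor_log n + 1) \<le> a * \<epsilon> * d n"
    using ev1 ev2 eventually_gt_at_top[of 0]
  proof eventually_elim
    case (elim n)
    let ?r = "real n powr (1 / 5)"
    have dr: "?r - 1 \<le> real (d n)" unfolding d_def by linarith
    have rd: "real (d n) \<le> ?r" unfolding d_def by (rule of_nat_floor) simp
    have "real (d n) ^ 5 \<le> ?r ^ 5" using rd by (intro power_mono) auto
    also have "\<dots> = real n" using elim(3) by (simp add: powr_powr flip: powr_realpow)
    finally have 1: "d n ^ 5 \<le> n" by (metis of_nat_le_iff of_nat_power)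
    have "116 / \<epsilon> \<le> d n" using elim(1) dr by simp
    then have 2: "116 \<le> \<epsilon> * d n" using \<epsilon> by (simp add: field_simps)
    have 3: "16 * K \<le> d n" using elim(1) dr by linarith
    have r1: "0 < ?r - 1" using elim(1) K1 by simp
    have "real (floor_log n) \<le> log 2 n"
      using elim(3) by (simp add: floor_log_altdef)
    then have "96 * (21 + 2 / a) * real (floor_log n + 1) \<le> 96 * (21 + 2 / a) * (log 2 n + 1)"
      using a by (intro mult_left_mono) auto
    also have "\<dots> \<le> a * \<epsilon> * (?r - 1)"
    proof -
      have "(log 2 n + 1) \<le> a * \<epsilon> / (96 * (21 + 2 / a)) * (?r - 1)"
        using elim(2) r1 by (simp only: pos_divide_less_eq less_imp_le)
      moreover have pos: "0 < 96 * (21 + 2 / a)" using a by (simp add: add_pos_pos)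
      ultimately have "96 * (21 + 2 / a) * (log 2 n + 1)
          \<le> 96 * (21 + 2 / a) * (a * \<epsilon> / (96 * (21 + 2 / a)) * (?r - 1))"
        by (intro mult_left_mono) simp_all
      also have "\<dots> = a * \<epsilon> * (?r - 1)"
        using pos by (metis mult.assoc nonzero_mult_div_cancel_left times_divide_eq_right less_irrefl)
      finally show ?thesis .
    qed
    also have "\<dots> \<le> a * \<epsilon> * d n" using dr a \<epsilon> by (intro mult_left_mono) auto
    finally show ?case using 1 2 3 by blast
  qed
  then obtain N where N: "\<And>n. N \<le> n \<Longrightarrow> 16 * K \<le> d n \<and> d n ^ 5 \<le> n \<and> 116 \<le> \<epsilon> * d n \<and>
      96 * (21 + 2 / a) * real (floor_log n + 1) \<le> a * \<epsilon> * d n"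
    unfolding eventually_sequentially by blast
  show ?thesis
  proof (intro exI[of _ N] allI impI)
    fix G :: "'a graph"
    assume "simple_graph G" "N < card (verts G)"
    then show "real (card (verts G)) / 2 - \<epsilon> * card (verts G) \<le> max_equal_pair G"
      using N[of "card (verts G)"] K1 K \<epsilon>
      by (intro max_equal_pair_lower_aux[where K = K and d = "d (card (verts G))"]) (auto simp: a_def)
  qed
qed

section \<open>The upper bound\<close>

text \<open>Cubing at each step lets a clique have more vertices than all smaller cliques together
  have edges, while about log log n cliques still fit. Even values make the clique sizes
  \<open>tower i - 1\<close> odd.\<close>

definition tower :: "nat \<Rightarrow> nat" where "tower i = 8 ^ 3 ^ i"

text \<open>Starting each block just above its tower value makes the blocks disjoint without running
  offsets.\<close>

definition block :: "nat \<Rightarrow> nat set" where "block i = {tower i + 1..<2 * tower i}"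

definition clique_union :: "nat \<Rightarrow> nat \<Rightarrow> nat graph" where
  "clique_union n k = ({..<n}, {e. \<exists>i<k. e \<subseteq> block i \<and> card e = 2})"

lemma tower_Suc: "tower (Suc i) = tower i ^ 3"
  by (simp add: tower_def mult.commute flip: power_mult)

lemma tower_ge: "8 \<le> tower i"
  using power_increasing[of 1 "3 ^ i" "8 :: nat"] by (simp add: tower_def)

lemma even_tower: "even (tower i)"
  by (simp add: tower_def)

lemma tower_mono: "i < j \<Longrightarrow> 2 * tower i \<le> tower j"
proof (induction j)
  case (Suc j)
  have "2 * tower j \<le> tower (Suc j)"
  proof -
    have "2 \<le> tower j * tower j" using tower_ge[of j] mult_le_mono[of 8 "tower j" 8 "tower j"] by simp
    then have "2 * tower j \<le> (tower j * tower j) * tower j" by (intro mult_right_mono) auto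
    then show ?thesis by (simp add: tower_Suc power3_eq_cube)
  qed
  then show ?case using Suc by (cases "i = j") auto
qed simp

lemma card_block: "card (block i) = tower i - 1"
  by (simp add: block_def)

lemma disjoint_blocks: "i \<noteq> j \<Longrightarrow> block i \<inter> block j = {}"
  using tower_mono[of i j] tower_mono[of j i] by (auto simp: block_def linorder_neq_iff)

text \<open>The square of \<open>tower i\<close> bounds twice the number of edges of clique
  \<open>i\<close>. The summand k + 2 is the slack that makes an unbalanced largest clique miss k +
  1 vertices in \<open>clique_deficit\<close>.\<close>

lemma sum_tower_squares: "(\<Sum>i<k. (tower i)\<^sup>2) + k + 2 < tower k"
proof (induction k)
  case 0
  then show ?case using tower_ge[of 0] by simp
next
  case (Suc k)
  have "tower k * 1 \<le> tower k * tower k" "1 * 1 \<le> tower k * tower k"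
    using tower_ge[of k] by (intro mult_le_mono; simp)+
  then have "tower k + (tower k)\<^sup>2 + 1 \<le> 3 * (tower k)\<^sup>2"
    unfolding power2_eq_square by linarith
  also have "\<dots> \<le> tower k * (tower k)\<^sup>2" using tower_ge[of k] by (intro mult_right_mono) auto
  also have "\<dots> = tower (Suc k)" by (simp add: tower_Suc power2_eq_square power3_eq_cube)
  finally show ?case using Suc by simp
qed

lemma twice_choose_2: "2 * (m choose 2) = m * (m - 1)"
  by (cases m) (simp_all add: choose_two)

text \<open>
  In the largest clique an imbalance between the two sets costs more edges than all smaller
  cliques contain, unless many vertices are missing; a balanced clique of odd size misses a vertex.
\<close>

lemma clique_deficit:
  fixes a b :: "nat \<Rightarrow> nat"
  assumes "\<And>i. i < k \<Longrightarrow> a i + b i \<le> tower i - 1"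
    and "(\<Sum>i<k. a i choose 2) = (\<Sum>i<k. b i choose 2)"
  shows "(\<Sum>i<k. a i + b i) + k \<le> (\<Sum>i<k. tower i - 1)"
  using assms
proof (induction k)
  case 0
  then show ?case by simp
next
  case (Suc k)
  have imb: "x k + y k + k + 1 \<le> tower k - 1"
    if xy: "y k < x k" "\<And>i. i < Suc k \<Longrightarrow> x i + y i \<le> tower i - 1"
      "(\<Sum>i<Suc k. x i choose 2) = (\<Sum>i<Suc k. y i choose 2)" for x y :: "nat \<Rightarrow> nat"
  proof -
    obtain e where e: "x k = y k + Suc e" using xy(1) less_iff_Suc_add by auto
    have "x k * (x k - 1) = (y k + Suc e) * (y k + e)" by (simp add: e)
    moreover have "y k * (y k - 1) + x k + y k \<le> (y k + Suc e) * (y k + e) + 1"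
      unfolding e by (cases "y k") (simp_all add: algebra_simps)
    ultimately have "y k * (y k - 1) + x k + y k \<le> x k * (x k - 1) + 1" by simp
    \<comment> \<open>Equality holds for x k = y k + 1. The sizes are thus controlled by the surplus
      of edges in the largest clique, for which the smaller cliques must compensate.\<close>
    then have 1: "2 * (y k choose 2) + x k + y k \<le> 2 * (x k choose 2) + 1"
      unfolding twice_choose_2 .
    have "2 * (\<Sum>i<k. y i choose 2) \<le> (\<Sum>i<k. (tower i)\<^sup>2)"
      unfolding sum_distrib_left
    proof (rule sum_mono)
      fix i assume "i \<in> {..<k}"
      then have "y i \<le> tower i" using xy(2)[of i] by simp
      then have "y i * (y i - 1) \<le> tower i * tower i" by (intro mult_le_mono) auto
      then show "2 * (y i choose 2) \<le> (tower i)\<^sup>2" unfolding twice_choose_2 power2_eq_square .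
    qed
    moreover have "(x k choose 2) \<le> (y k choose 2) + (\<Sum>i<k. y i choose 2)" using xy(3) by simp
    ultimately show ?thesis using 1 sum_tower_squares[of k] by linarith
  qed
  have IH: "(\<Sum>i<k. a i + b i) + k \<le> (\<Sum>i<k. tower i - 1)" if "a k = b k"
    using Suc.IH Suc.prems that by simp
  have le: "(\<Sum>i<k. a i + b i) \<le> (\<Sum>i<k. tower i - 1)"
    using Suc.prems(1) by (intro sum_mono) auto
  consider "a k = b k" | "a k < b k" | "b k < a k" by linarith
  then show ?case
  proof cases
    case 1
    have "a k + b k \<noteq> tower k - 1" using 1 even_tower[of k] tower_ge[of k] by presburger
    then show ?thesis using IH[OF 1] Suc.prems(1)[of k] by simp
  next
    case 2
    then show ?thesis using imb[of a b] Suc.prems le by (simp add: add.commute)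
  next
    case 3
    then show ?thesis using imb[of b a] Suc.prems le by simp
  qed
qed

lemma card_edges_clique_union:
  assumes "finite A"
  shows "card (edges (induced_subgraph (clique_union n k) A)) = (\<Sum>i<k. card (A \<inter> block i) choose 2)"
proof -
  let ?F = "\<lambda>i. {e. e \<subseteq> A \<inter> block i \<and> card e = 2}"
  have "edges (induced_subgraph (clique_union n k) A) = (\<Union>i<k. ?F i)"
    by (auto simp: induced_subgraph_def clique_union_def)
  also have "card \<dots> = (\<Sum>i<k. card (?F i))"
  proof (rule card_UN_disjoint)
    show "\<forall>i\<in>{..<k}. finite (?F i)" using assms by simp
    show "\<forall>i\<in>{..<k}. \<forall>j\<in>{..<k}. i \<noteq> j \<longrightarrow> ?F i \<inter> ?F j = {}"
    proof (intro ballI impI)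
      fix i j :: nat assume "i \<noteq> j"
      then have "block i \<inter> block j = {}" by (rule disjoint_blocks)
      then have "e = {}" if "e \<in> ?F i \<inter> ?F j" for e using that by blast
      moreover have "e \<noteq> {}" if "e \<in> ?F i" for e using that by auto
      ultimately show "?F i \<inter> ?F j = {}" by blast
    qed
  qed simp
  also have "\<dots> = (\<Sum>i<k. card (A \<inter> block i) choose 2)"
    using assms by (intro sum.cong refl n_subsets finite_Int disjI1)
  finally show ?thesis .
qed

text \<open>The assumption makes room for all blocks below \<open>n\<close>. Vertices outside them
  are isolated, so the loss that is counted occurs inside the cliques.\<close>

lemma max_equal_pair_clique_union:
  assumes "2 * tower k \<le> n"
  shows "simple_graph (clique_union n k)" "2 * max_equal_pair (clique_union n k) + k \<le> n"
proof -
  let ?G = "clique_union n k" and ?S = "\<Union>i<k. block i"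
  have "2 * tower i \<le> n" if "i < k" for i using tower_mono[OF that] assms by linarith
  then have sub: "block i \<subseteq> {..<n}" if "i < k" for i using that by (force simp: block_def)
  then show G: "simple_graph ?G" by (fastforce simp: simple_graph_def clique_union_def)
  have vG: "verts ?G = {..<n}" by (simp add: clique_union_def)
  obtain A B where AB: "A \<subseteq> {..<n}" "B \<subseteq> {..<n}" "A \<inter> B = {}" "card A = max_equal_pair ?G"
    "card B = max_equal_pair ?G" "card (edges (induced_subgraph ?G A)) = card (edges (induced_subgraph ?G B))"
    by (rule max_equal_pair_witness[OF G, unfolded vG])
  have fin: "finite A" "finite B"
    using finite_subset[OF AB(1)] finite_subset[OF AB(2)] by simp_all
  have finb: "finite (block i)" for i by (simp add: block_def)
  have cUN: "card (C \<inter> ?S) = (\<Sum>i<k. card (C \<inter> block i))" for C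
  proof -
    have "(C \<inter> block i) \<inter> (C \<inter> block j) = {}" if "i \<noteq> j" for i j
      using disjoint_blocks[OF that] by blast
    then show ?thesis unfolding Int_UN_distrib using finb by (intro card_UN_disjoint) simp_all
  qed
  have ab: "card (A \<inter> block i) + card (B \<inter> block i) = card ((A \<union> B) \<inter> block i)" for i
    unfolding Int_Un_distrib2 using fin AB(3) by (intro card_Un_disjoint[symmetric]) auto
  have "(\<Sum>i<k. card (A \<inter> block i) + card (B \<inter> block i)) + k \<le> (\<Sum>i<k. tower i - 1)"
  proof (rule clique_deficit)
    show "card (A \<inter> block i) + card (B \<inter> block i) \<le> tower i - 1" for i
      unfolding ab card_block[symmetric] by (intro card_mono finb) auto
  qed (use AB(6) fin in \<open>simp add: card_edges_clique_union\<close>)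
  then have "card ((A \<union> B) \<inter> ?S) + k \<le> card ?S"
    using cUN[of "A \<union> B"] cUN[of UNIV] by (simp add: ab card_block)
  moreover have "card (A \<union> B) = card ((A \<union> B) \<inter> ?S) + card ((A \<union> B) - ?S)"
    using fin by (metis card_Int_Diff finite_Un)
  moreover have "card ((A \<union> B) - ?S) \<le> card ({..<n} - ?S)" using AB by (intro card_mono) auto
  moreover have "card ({..<n} - ?S) = n - card ?S" "card ?S \<le> n"
  proof -
    have S: "?S \<subseteq> {..<n}" using sub by blast
    then show "card ({..<n} - ?S) = n - card ?S" using finb by (subst card_Diff_subset) auto
    show "card ?S \<le> n" using card_mono[OF _ S] by simp
  qed
  moreover have "card (A \<union> B) = 2 * max_equal_pair ?G"
    using fin AB(3-5) by (simp add: card_Un_disjoint)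
  ultimately show "2 * max_equal_pair ?G + k \<le> n" by linarith
qed

section \<open>From single graphs to the minimum over all graphs\<close>

lemma two_max_equal_pair_le:
  assumes "simple_graph G"
  shows "2 * max_equal_pair G \<le> card (verts G)"
proof -
  have fV: "finite (verts G)" using assms by (simp add: simple_graph_def)
  obtain A B where AB: "A \<subseteq> verts G" "B \<subseteq> verts G" "A \<inter> B = {}"
    "card A = max_equal_pair G" "card B = max_equal_pair G"
    using max_equal_pair_witness[OF assms] by metis
  have "card (A \<union> B) = card A + card B"
    using AB fV finite_subset by (intro card_Un_disjoint) blast+
  moreover have "card (A \<union> B) \<le> card (verts G)" using AB fV by (intro card_mono) auto
  ultimately show ?thesis using AB by simp
qed

lemma min_max_equal_pair_set_finite:
  "finite {max_equal_pair G | G :: nat graph. simple_graph G \<and> card (verts G) = n}"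
  by (rule finite_subset[of _ "{..n}"]) (use two_max_equal_pair_le in fastforce)+

lemma min_max_equal_pair_le:
  fixes G :: "nat graph"
  assumes "simple_graph G"
  shows "min_max_equal_pair (card (verts G)) \<le> max_equal_pair G"
  unfolding min_max_equal_pair_def
  by (rule Min_le[OF min_max_equal_pair_set_finite]) (use assms in blast)

lemma min_max_equal_pair_attained:
  obtains G :: "nat graph" where "simple_graph G" "card (verts G) = n" "max_equal_pair G = min_max_equal_pair n"
proof -
  let ?M = "{max_equal_pair G | G :: nat graph. simple_graph G \<and> card (verts G) = n}"
  have "simple_graph ({..<n}, {})" "card (verts ({..<n}, {} :: nat set set)) = n"
    by (auto simp: simple_graph_def)
  then have "?M \<noteq> {}" by blast
  then have "Min ?M \<in> ?M" by (rule Min_in[OF min_max_equal_pair_set_finite])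
  then show ?thesis using that unfolding min_max_equal_pair_def by force
qed

text \<open>From 3 <= exp(3/2) it follows that 3^k is at most (ln n)^(3/4), so the logarithm of the
  tower is of lower order than ln n. The factor 1/2 in front of ln ln n brings the exponent below
  1.\<close>

lemma two_tower_le_eventually:
  "\<forall>\<^sub>F n in sequentially. 2 * tower (nat \<lfloor>ln (ln (real n)) / 2\<rfloor>) \<le> n"
proof -
  have three: "(3 :: real) \<le> exp (3 / 2)"
    using exp_lower_Taylor_quadratic[of "3 / 2"] by (simp add: power2_eq_square)
  have "\<forall>\<^sub>F n in sequentially. ln 2 + ln 8 * exp (3 / 4 * ln (ln (real n))) \<le> ln (real n)"
    by real_asymp
  moreover have "\<forall>\<^sub>F n in sequentially. 0 \<le> ln (ln (real n))" by real_asymp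
  ultimately show ?thesis
    using eventually_gt_at_top[of 0]
  proof eventually_elim
    case (elim n)
    let ?k = "nat \<lfloor>ln (ln (real n)) / 2\<rfloor>"
    have "real ?k \<le> ln (ln (real n)) / 2" using elim(2) by (intro of_nat_floor) simp
    then have "real ?k * (3 / 2) \<le> 3 / 4 * ln (ln (real n))" by linarith
    then have "exp (3 / 2) ^ ?k \<le> exp (3 / 4 * ln (ln (real n)))"
      by (simp only: exp_of_nat_mult[symmetric] exp_le_cancel_iff)
    then have "3 ^ ?k \<le> exp (3 / 4 * ln (ln (real n)))"
      using power_mono[OF three, of ?k] by linarith
    then have "ln 8 * (3 :: real) ^ ?k \<le> ln 8 * exp (3 / 4 * ln (ln (real n)))"
      by (intro mult_left_mono) simp_all
    then have "ln 2 + ln 8 * (3 :: real) ^ ?k \<le> ln (real n)" using elim(1) by linarith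
    moreover have "ln (real (2 * tower ?k)) = ln 2 + ln 8 * (3 :: real) ^ ?k"
      by (simp add: tower_def ln_mult ln_realpow mult.commute)
    moreover have "0 < real (2 * tower ?k)" using tower_ge[of ?k] by simp
    ultimately have "real (2 * tower ?k) \<le> real n" using elim(3) by (metis ln_le_cancel_iff of_nat_0_less_iff)
    then show ?case by (simp only: of_nat_le_iff)
  qed
qed

theorem theorem1p1:
  shows "(\<forall>\<epsilon>::real. \<epsilon> > 0 \<longrightarrow> (\<exists>N::nat. \<forall>G :: 'a graph. \<forall>n::nat.
            simple_graph G \<and> card (verts G) = n \<and> n > N \<longrightarrow>
            real (max_equal_pair G) \<ge> real n / 2 - \<epsilon> * real n))
       \<and> (\<exists>g :: nat \<Rightarrow> real. g \<in> o(\<lambda>n. real n) \<and>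
            (\<forall>\<^sub>F n in sequentially. real n / 2 - g n \<le> real (min_max_equal_pair n)))
       \<and> (\<exists>h :: nat \<Rightarrow> real. h \<in> \<Omega>(\<lambda>n. ln (ln (real n))) \<and>
            (\<forall>\<^sub>F n in sequentially. h n \<ge> 0) \<and>
            (\<forall>\<^sub>F n in sequentially. real (min_max_equal_pair n) \<le> real n / 2 - h n))"
proof (intro conjI)
  show "\<forall>\<epsilon>::real. \<epsilon> > 0 \<longrightarrow> (\<exists>N::nat. \<forall>G :: 'a graph. \<forall>n::nat.
            simple_graph G \<and> card (verts G) = n \<and> n > N \<longrightarrow>
            real (max_equal_pair G) \<ge> real n / 2 - \<epsilon> * real n)"
    using max_equal_pair_lower[where ?'a = 'a] by blast
next
  \<comment> \<open>The exact deficit serves as \<open>g\<close>; a graph attaining the minimum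
    transfers the bound for single graphs to it.\<close>
  let ?g = "\<lambda>n. real n / 2 - real (min_max_equal_pair n)"
  have "?g \<in> o(\<lambda>n. real n)"
  proof (rule landau_o.smallI)
    fix c :: real assume "0 < c"
    then obtain N where N: "\<And>G :: nat graph. simple_graph G \<Longrightarrow> N < card (verts G) \<Longrightarrow>
        real (card (verts G)) / 2 - c * card (verts G) \<le> max_equal_pair G"
      using max_equal_pair_lower[where ?'a = nat] by blast
    show "\<forall>\<^sub>F n in sequentially. norm (?g n) \<le> c * norm (real n)"
      using eventually_gt_at_top[of N]
    proof eventually_elim
      case (elim n)
      obtain G :: "nat graph" where G: "simple_graph G" "card (verts G) = n"
        "max_equal_pair G = min_max_equal_pair n" by (rule min_max_equal_pair_attained)
      have "2 * real (min_max_equal_pair n) \<le> real n"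
        using two_max_equal_pair_le[OF G(1)] G(2,3) by linarith
      then show ?case using N[OF G(1)] elim G(2,3) by simp
    qed
  qed
  then show "\<exists>g :: nat \<Rightarrow> real. g \<in> o(\<lambda>n. real n) \<and>
      (\<forall>\<^sub>F n in sequentially. real n / 2 - g n \<le> real (min_max_equal_pair n))"
    by (intro exI[of _ ?g]) simp
next
  let ?k = "\<lambda>n. nat \<lfloor>ln (ln (real n)) / 2\<rfloor>"
  \<comment> \<open>Rounding leaves at least (ln ln n)/4 - 1/2, which is at least (ln ln n)/8 as
    soon as ln ln n >= 4.\<close>
  let ?h = "\<lambda>n. real (?k n) / 2"
  have "\<forall>\<^sub>F n in sequentially. 4 \<le> ln (ln (real n))" by real_asymp
  then have "\<forall>\<^sub>F n in sequentially. 1 / 8 * norm (ln (ln (real n))) \<le> norm (?h n)"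
  proof eventually_elim
    case (elim n)
    have "ln (ln (real n)) / 2 - 1 \<le> real (?k n)" by linarith
    moreover have "norm (ln (ln (real n))) = ln (ln (real n))" "norm (?h n) = ?h n"
      using elim by simp_all
    ultimately show ?case using elim by linarith
  qed
  then have "?h \<in> \<Omega>(\<lambda>n. ln (ln (real n)))" by (intro landau_omega.bigI[of "1 / 8"]) auto
  moreover have "\<forall>\<^sub>F n in sequentially. real (min_max_equal_pair n) \<le> real n / 2 - ?h n"
    using two_tower_le_eventually
  proof eventually_elim
    case (elim n)
    have "card (verts (clique_union n (?k n))) = n" by (simp add: clique_union_def)
    then have "min_max_equal_pair n \<le> max_equal_pair (clique_union n (?k n))"
      using min_max_equal_pair_le[OF max_equal_pair_clique_union(1)[OF elim]] by simp
    then show ?case using max_equal_pair_clique_union(2)[OF elim] by linarith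
  qed
  ultimately show "\<exists>h :: nat \<Rightarrow> real. h \<in> \<Omega>(\<lambda>n. ln (ln (real n))) \<and>
      (\<forall>\<^sub>F n in sequentially. h n \<ge> 0) \<and>
      (\<forall>\<^sub>F n in sequentially. real (min_max_equal_pair n) \<le> real n / 2 - h n)"
    by (intro exI[of _ ?h]) simp
qed

end
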